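(* Let $F$ be a totally real number field of degree $n$ in which $2$ splits completely, and let $w_1,\dots,w_n\in\{1/2,3/2\}$. (1) If $|S_2|+|S_\infty|$ is even, then there exists $(\beta,S_3,\mathfrak a)\in\mathbf G$ if and only if $[\mathfrak d]\in\bar H$. (2) If $|S_2|+|S_\infty|$ is odd, then there exists $(\beta,S_3,\mathfrak a)\in\mathbf G$ if and only if $T_3\neq\emptyset$ and $[\mathfrak d\mathfrak p_{v_0}]\in\bar H$, where $v_0$ is any fixed element of $T_3$.
   Context: $F$ has real embeddings $\infty_1,\dots,\infty_n$, different $\mathfrak d$ of $F/\mathbb Q$, and $F^\times_+$ denotes the totally positive elements. For a finite place $v$, $\mathfrak p_v$ is the corresponding prime ideal, $q_v$ its residue field order, $F_v$ the completion. Put $S_2=\{v<\infty:F_v=\mathbb Q_2\}$, $T_3=\{v<\infty: q_v=3\}$, $S_\infty=\{\infty_i: w_i=3/2\}$. $\mathbf G$ is the set of triples $(\beta,S_3,\mathfrak a)$ with $\beta\in F^\times_+$, $S_3\subset T_3$, $\mathfrak a$ a fractional ideal of $F$, such that $|S_2|+|S_3|+|S_\infty|$ is even and $(8\beta)\mathfrak d\prod_{v\in S_3}\mathfrak p_v=\mathfrak a^2$. Let $H$ be the group of fractional ideals of the form $\prod_{v\in T_3}\mathfrak p_v^{e_v}$ with $\sum_v e_v$ even. Let $\mathrm{Cl}^+$ be the narrow ideal class group, $\mathrm{Cl}^{+2}$ its subgroup of squares, and $\bar H$, $[\mathfrak b]$ the images of $H$ and of a fractional ideal $\mathfrak b$ in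 $\mathrm{Cl}^+/\mathrm{Cl}^{+2}$. *)

theory Defs
  imports
    Complex_Main
    "HOL-Computational_Algebra.Polynomial"
    "HOL-Algebra.QuotRing"
    "HOL-Algebra.FiniteProduct"
begin

section \<open>Number fields\<close>

definition rat_scale :: "rat \<Rightarrow> 'a::field_char_0 \<Rightarrow> 'a" where
  "rat_scale q x = of_rat q * x"

interpretation rat_vs: vector_space "rat_scale :: rat \<Rightarrow> 'a::field_char_0 \<Rightarrow> 'a"
  by unfold_locales (simp_all add: rat_scale_def algebra_simps of_rat_add of_rat_mult)

text \<open>A number field is a whole type; every number field, being a nonempty set, occurs as a type.\<close>

definition number_field :: "'a::field_char_0 itself \<Rightarrow> bool" where
  "number_field _ \<longleftrightarrow> (\<exists>B :: 'a set. finite B \<and> rat_vs.span B = UNIV)"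

definition field_degree :: "'a::field_char_0 itself \<Rightarrow> nat" where
  "field_degree _ = rat_vs.dim (UNIV :: 'a set)"

definition embeddings :: "('a::field \<Rightarrow> 'b::field) set" where
  "embeddings = {\<sigma>. \<sigma> 1 = 1 \<and> (\<forall>x y. \<sigma> (x + y) = \<sigma> x + \<sigma> y) \<and> (\<forall>x y. \<sigma> (x * y) = \<sigma> x * \<sigma> y)}"

definition totally_real :: "'a::field_char_0 itself \<Rightarrow> bool" where
  "totally_real _ \<longleftrightarrow> (\<forall>\<sigma> \<in> (embeddings :: ('a \<Rightarrow> complex) set). range \<sigma> \<subseteq> \<real>)"

definition totally_positive :: "'a::field_char_0 set" where
  "totally_positive = {x. x \<noteq> 0 \<and> (\<forall>\<sigma> \<in> (embeddings :: ('a \<Rightarrow> real) set). \<sigma> x > 0)}"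

text \<open>Trace of the \<open>\<rat>\<close>-linear map \<open>y \<mapsto> x y\<close>, as the sum of the diagonal entries of its
  matrix in some basis (the choice of basis does not matter).\<close>

definition field_trace :: "'a::field_char_0 \<Rightarrow> rat" where
  "field_trace x =
     (let B = (SOME B. rat_vs.independent B \<and> rat_vs.span B = UNIV)
      in \<Sum>b\<in>B. rat_vs.representation B (x * b) b)"


section \<open>Ideals\<close>

definition integer_ring :: "'a::field_char_0 ring" where
  "integer_ring = \<lparr>carrier = {x. algebraic_int x}, monoid.mult = (*), one = 1, zero = 0, add = (+)\<rparr>"

definition fractional_ideal :: "'a::field_char_0 set \<Rightarrow> bool" where
  "fractional_ideal I \<longleftrightarrow>
     0 \<in> I \<and> I \<noteq> {0} \<and>
     (\<forall>x\<in>I. \<forall>y\<in>I. x + y \<in> I) \<and>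
     (\<forall>a x. algebraic_int a \<longrightarrow> x \<in> I \<longrightarrow> a * x \<in> I) \<and>
     (\<exists>d. d \<noteq> 0 \<and> algebraic_int d \<and> (\<forall>x\<in>I. algebraic_int (d * x)))"

definition ideal_mult :: "'a::field_char_0 set \<Rightarrow> 'a set \<Rightarrow> 'a set" where
  "ideal_mult I J =
     {\<Sum>i<k. f i * g i | (k::nat) f g. (\<forall>i<k. f i \<in> I) \<and> (\<forall>i<k. g i \<in> J)}"

definition ideal_group :: "'a::field_char_0 set monoid" where
  "ideal_group = \<lparr>carrier = {I. fractional_ideal I}, monoid.mult = ideal_mult, one = {x. algebraic_int x}\<rparr>"

definition principal :: "'a::field_char_0 \<Rightarrow> 'a set" where
  "principal x = {x * y | y. algebraic_int y}"

definition codifferent :: "'a::field_char_0 set" where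
  "codifferent = {x. \<forall>y. algebraic_int y \<longrightarrow> field_trace (x * y) \<in> \<int>}"

definition different :: "'a::field_char_0 set" where
  "different = inv\<^bsub>ideal_group\<^esub> codifferent"


section \<open>Finite places and completions\<close>

text \<open>A finite place is identified with its prime ideal.\<close>

definition finite_places :: "'a::field_char_0 set set" where
  "finite_places = {v. primeideal v integer_ring \<and> v \<noteq> {0}}"

definition residue_order :: "'a::field_char_0 set \<Rightarrow> nat" where
  "residue_order v = card (carrier (integer_ring Quot v))"

text \<open>The exponent of \<open>v\<close> in the prime factorization of \<open>I\<close>.\<close>

definition ideal_exponent :: "'a::field_char_0 set \<Rightarrow> 'a set \<Rightarrow> int" where
  "ideal_exponent v I =
     (THE k. \<exists>e :: 'a set \<Rightarrow> int.
        finite {u \<in> finite_places. e u \<noteq> 0} \<and>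
        I = (\<Otimes>\<^bsub>ideal_group\<^esub>u\<in>{u \<in> finite_places. e u \<noteq> 0}. u [^]\<^bsub>ideal_group\<^esub> e u) \<and>
        e v = k)"

definition place_abs :: "'a::field_char_0 set \<Rightarrow> 'a \<Rightarrow> real" where
  "place_abs v x =
     (if x = 0 then 0 else real (residue_order v) powi (- ideal_exponent v (principal x)))"

definition cauchy_ring :: "('a::field \<Rightarrow> real) \<Rightarrow> (nat \<Rightarrow> 'a) ring" where
  "cauchy_ring a =
     \<lparr>carrier = {X. \<forall>e>0. \<exists>N. \<forall>i\<ge>N. \<forall>j\<ge>N. a (X i - X j) < e},
      monoid.mult = (\<lambda>X Y i. X i * Y i), one = (\<lambda>_. 1), zero = (\<lambda>_. 0), add = (\<lambda>X Y i. X i + Y i)\<rparr>"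

definition null_seqs :: "('a::field \<Rightarrow> real) \<Rightarrow> (nat \<Rightarrow> 'a) set" where
  "null_seqs a = {X. (\<lambda>i. a (X i)) \<longlonglongrightarrow> 0}"

definition completion :: "('a::field \<Rightarrow> real) \<Rightarrow> (nat \<Rightarrow> 'a) set ring" where
  "completion a = cauchy_ring a Quot null_seqs a"

definition completion_abs :: "('a::field \<Rightarrow> real) \<Rightarrow> (nat \<Rightarrow> 'a) set \<Rightarrow> real" where
  "completion_abs a c = (THE r. \<forall>X\<in>c. (\<lambda>i. a (X i)) \<longlonglongrightarrow> r)"

definition isometric_completions ::
    "('a::field \<Rightarrow> real) \<Rightarrow> ('b::field \<Rightarrow> real) \<Rightarrow> bool" where
  "isometric_completions a b \<longleftrightarrow>
     (\<exists>\<phi> \<in> ring_iso (completion a) (completion b).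
        \<forall>c \<in> carrier (completion a). completion_abs b (\<phi> c) = completion_abs a c)"

text \<open>\<open>F\<^sub>v = \<rat>\<^sub>2\<close> is read as an isomorphism of valued fields; \<open>\<rat>\<^sub>2\<close> is the completion
  of \<open>\<rat>\<close> at its place \<open>2\<int>\<close>. Both absolute values are normalized by the order of the
  residue field, so every isomorphism of topological fields is isometric.\<close>

definition S2 :: "'a::field_char_0 set set" where
  "S2 = {v \<in> finite_places.
           isometric_completions (place_abs (principal (2::rat))) (place_abs v)}"

definition T3 :: "'a::field_char_0 set set" where
  "T3 = {v \<in> finite_places. residue_order v = 3}"

definition splits_completely :: "nat \<Rightarrow> 'a::field_char_0 itself \<Rightarrow> bool" where
  "splits_completely p _ \<longleftrightarrow>
     (\<exists>V :: 'a set set. V \<subseteq> finite_places \<and> finite V \<and> card V = field_degree TYPE('a) \<and>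
        principal (of_nat p) = (\<Otimes>\<^bsub>ideal_group\<^esub>v\<in>V. v))"


section \<open>Narrow class group\<close>

definition narrow_principal :: "'a::field_char_0 set set" where
  "narrow_principal = principal ` totally_positive"

definition narrow_class_group :: "'a::field_char_0 set set monoid" where
  "narrow_class_group = ideal_group Mod narrow_principal"

definition narrow_class_squares :: "'a::field_char_0 set set set" where
  "narrow_class_squares =
     (\<lambda>c. c \<otimes>\<^bsub>narrow_class_group\<^esub> c) ` carrier narrow_class_group"

text \<open>The class of a fractional ideal in the group
  \<open>narrow_class_group Mod narrow_class_squares\<close>.\<close>

definition class_mod_squares :: "'a::field_char_0 set \<Rightarrow> 'a set set set" where
  "class_mod_squares I =
     narrow_class_squares #>\<^bsub>narrow_class_group\<^esub> (narrow_principal #>\<^bsub>ideal_group\<^esub> I)"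

definition H_group :: "'a::field_char_0 set set" where
  "H_group = {(\<Otimes>\<^bsub>ideal_group\<^esub>v\<in>T3. v [^]\<^bsub>ideal_group\<^esub> e v) | e :: 'a set \<Rightarrow> int. even (\<Sum>v\<in>T3. e v)}"

definition H_bar :: "'a::field_char_0 set set set set" where
  "H_bar = class_mod_squares ` H_group"


section \<open>The set of triples\<close>

definition S_infty ::
    "nat \<Rightarrow> (nat \<Rightarrow> 'a \<Rightarrow> real) \<Rightarrow> (nat \<Rightarrow> real) \<Rightarrow> ('a::field_char_0 \<Rightarrow> real) set" where
  "S_infty n infty w = infty ` {i \<in> {1..n}. w i = 3/2}"

definition G_triples :: "('a::field_char_0 \<Rightarrow> real) set \<Rightarrow> ('a \<times> 'a set set \<times> 'a set) set" where
  "G_triples Sinf =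
     {(\<beta>, S3, I). \<beta> \<in> totally_positive \<and> S3 \<subseteq> T3 \<and> fractional_ideal I \<and>
        even (card (S2 :: 'a set set) + card S3 + card Sinf) \<and>
        principal (8 * \<beta>) \<otimes>\<^bsub>ideal_group\<^esub> different \<otimes>\<^bsub>ideal_group\<^esub> (\<Otimes>\<^bsub>ideal_group\<^esub>v\<in>S3. v)
          = I \<otimes>\<^bsub>ideal_group\<^esub> I}"

end

(* With K the subgroup of fractional ideals (p) c^2, p totally positive, all statements concern the
   class of d modulo K. As 8 is totally positive, a triple exists iff d times the product of S_3 lies
   in K for some S_3 of the right parity. Modulo squares only the parity of each exponent e_v matters,
   so S_3 may be replaced by a product of p_v^(e_v) over T_3 with the same parity of the sum of the e_v;
   multiplying by p_(v_0) shifts that parity.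

   This needs that fractional ideals form a group containing d and that T_3 is finite. The trace form
   is integral and nondegenerate, so the codifferent lies in a lattice, which makes O/mO finite.
   If J = I I^(-1) were proper, an annihilator of J in the finite ring O/mO with m in J would give
   x outside O with x J in O; then x I^(-1) lies in I^(-1), all powers of x have a common denominator,
   and two of them are congruent modulo O, which makes x an algebraic integer. *)

theory Submission
  imports Defs "Jordan_Normal_Form.Schur_Decomposition" "HOL-Algebra.Multiplicative_Group"
begin

section \<open>The ring of algebraic integers\<close>

text \<open>Invertibility is proved for all fractional ideals at once rather than prime by prime. It
  rests on two facts: the denominators in a fractional ideal are bounded, and O/mO is finite for
  every positive integer m. For the second, write every algebraic integer of F as an integral
  combination of fixed elements c_b, the trace-dual basis of an integral rational basis. The c_b are
  only integral up to a factor N, so coefficients are compared modulo mN: if those of x and s agree,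
  then x - s lies in mO. The pigeonhole principle on O/mO then acts twice. On the powers of an
  element t of J it gives t^k (1 - t^(l-k)) = 0, the source of the annihilator. On the integers m
  x^k it gives x^l - x^k in O. For m = 3 the same finiteness bounds T_3, because every place in T_3
  contains 3.\<close>

text \<open>The vector of the \<open>v i\<close> is a nonzero eigenvector, with eigenvalue
  \<open>x\<close>, of the integer matrix \<open>c\<close>, whose characteristic polynomial is monic
  and integral. The index set is arbitrary so that both pairs of exponents and basis elements can
  index the lattice.\<close>

lemma algebraic_int_if_lattice_stable:
  fixes x :: "'a::field_char_0" and v :: "'i \<Rightarrow> 'a"
  assumes fin: "finite I" and z: "z \<in> I" "v z \<noteq> 0"
    and stable: "\<And>i. i \<in> I \<Longrightarrow> x * v i = (\<Sum>j\<in>I. of_int (c i j) * v j)"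
  shows "algebraic_int x"
proof -
  define n where "n = card I"
  obtain h where h: "bij_betw h {0..<n} I"
    using ex_bij_betw_nat_finite[OF fin] unfolding n_def by blast
  define M :: "int mat" where "M = mat n n (\<lambda>(i, j). c (h i) (h j))"
  define A :: "'a mat" where "A = map_mat of_int M"
  define u where "u = vec n (\<lambda>i. v (h i))"
  have M: "M \<in> carrier_mat n n" and A: "A \<in> carrier_mat n n" by (auto simp: M_def A_def)
  have "u \<in> carrier_vec n" by (simp add: u_def)
  moreover have "u \<noteq> 0\<^sub>v n"
  proof -
    obtain k where "k < n" "h k = z" using h z(1) by (auto simp: bij_betw_def)
    hence "u $ k \<noteq> 0\<^sub>v n $ k" using z by (simp add: u_def)
    thus ?thesis by metis
  qed
  moreover have "A *\<^sub>v u = x \<cdot>\<^sub>v u"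
  proof (rule eq_vecI)
    fix i assume "i < dim_vec (x \<cdot>\<^sub>v u)"
    hence i: "i < n" by (simp add: u_def)
    hence hi: "h i \<in> I" using h by (auto simp: bij_betw_def)
    have "(A *\<^sub>v u) $ i = (\<Sum>j = 0..<n. of_int (c (h i) (h j)) * v (h j))"
      using i by (simp add: A_def M_def u_def scalar_prod_def)
    also have "\<dots> = (\<Sum>j\<in>I. of_int (c (h i) j) * v j)"
      by (rule sum.reindex_bij_betw[OF h])
    also have "\<dots> = (x \<cdot>\<^sub>v u) $ i" using stable[OF hi] i by (simp add: u_def)
    finally show "(A *\<^sub>v u) $ i = (x \<cdot>\<^sub>v u) $ i" .
  qed (simp add: A_def M_def u_def)
  ultimately have "eigenvalue A x"
    unfolding eigenvalue_def eigenvector_def using A by auto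
  hence "poly (char_poly A) x = 0" using eigenvalue_root_char_poly[OF A] by simp
  moreover have "char_poly A = map_poly of_int (char_poly M)"
    unfolding A_def by (rule of_int_hom.char_poly_hom[OF M])
  moreover have "lead_coeff (char_poly M) = 1" using degree_monic_char_poly[OF M] by simp
  ultimately show ?thesis unfolding algebraic_int_altdef_ipoly by auto
qed

text \<open>The coefficients form the companion matrix of a monic integral polynomial of
  \<open>a\<close>. Positivity of \<open>m\<close> keeps the nonzero element 1 among the
  powers.\<close>

lemma algebraic_int_power_basis:
  fixes a :: "'a::field_char_0"
  assumes "algebraic_int a"
  obtains m c where "m > 0" "\<And>i. i < m \<Longrightarrow> a * a ^ i = (\<Sum>j<m. of_int (c i j) * a ^ j)"
proof -
  obtain p where p: "poly (map_poly of_int p) a = 0" "lead_coeff p = 1"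
    using assms unfolding algebraic_int_altdef_ipoly by auto
  define m where "m = degree p"
  have "0 = (\<Sum>j\<le>m. of_int (Polynomial.coeff p j) * a ^ j)"
    using p(1) by (simp add: poly_altdef coeff_map_poly degree_map_poly m_def)
  also have "{..m} = insert m {..<m}" by auto
  finally have am: "a ^ m = (\<Sum>j<m. of_int (- Polynomial.coeff p j) * a ^ j)"
    using p(2) by (simp add: m_def sum_negf eq_neg_iff_add_eq_0)
  have "m > 0"
    using am by (cases "m = 0") auto
  \<comment> \<open>All rows but the last shift the power by one; the last row is the equation for
    \<open>a ^ m\<close>.\<close>
  moreover have "a * a ^ i =
      (\<Sum>j<m. of_int (if Suc i < m then of_bool (j = Suc i) else - Polynomial.coeff p j) * a ^ j)"
    if "i < m" for i
  proof (cases "Suc i < m")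
    case True
    have "(\<Sum>j<m. of_int (of_bool (j = Suc i)) * a ^ j) = (\<Sum>j<m. if j = Suc i then a ^ j else 0)"
      by (rule sum.cong) auto
    also have "\<dots> = a * a ^ i" using True by simp
    finally show ?thesis using True by simp
  next
    case False
    hence "m = Suc i" using that by simp
    thus ?thesis using am by simp
  qed
  ultimately show ?thesis by (rule that)
qed

text \<open>The lattice of the products \<open>a ^ i * b ^ j\<close> is stable under
  \<open>a\<close> and \<open>b\<close>. In it, \<open>a * b\<close> acts by the Kronecker product
  of the two companion matrices and \<open>a + b\<close> by their Kronecker sum.\<close>

lemma
  fixes a b :: "'a::field_char_0"
  assumes a: "algebraic_int a" and b: "algebraic_int b"
  shows algebraic_int_plus: "algebraic_int (a + b)"
    and algebraic_int_times: "algebraic_int (a * b)"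
proof -
  obtain m c where m: "m > 0" "\<And>i. i < m \<Longrightarrow> a * a ^ i = (\<Sum>j<m. of_int (c i j) * a ^ j)"
    using algebraic_int_power_basis[OF a] by metis
  obtain k d where k: "k > 0" "\<And>i. i < k \<Longrightarrow> b * b ^ i = (\<Sum>j<k. of_int (d i j) * b ^ j)"
    using algebraic_int_power_basis[OF b] by metis
  define v where "v = (\<lambda>(i, j). a ^ i * b ^ j)"
  have S: "finite ({..<m} \<times> {..<k})" "(0, 0) \<in> {..<m} \<times> {..<k}" "v (0, 0) \<noteq> 0"
    using m(1) k(1) by (auto simp: v_def)
  show "algebraic_int (a * b)"
  proof (rule algebraic_int_if_lattice_stable[where z = "(0, 0)" and v = v
        and c = "\<lambda>(i, j) (i', j'). c i i' * d j j'", OF S])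
    fix y assume "y \<in> {..<m} \<times> {..<k}"
    then obtain i j where y: "y = (i, j)" and ij: "i < m" "j < k" by auto
    have "a * b * v (i, j) = (a * a ^ i) * (b * b ^ j)" by (simp add: v_def)
    also have "\<dots> = (\<Sum>i'<m. \<Sum>j'<k. of_int (c i i' * d j j') * v (i', j'))"
      unfolding m(2)[OF ij(1)] k(2)[OF ij(2)] sum_product
      by (intro sum.cong refl) (simp add: v_def)
    also have "\<dots> = (\<Sum>(i', j')\<in>{..<m} \<times> {..<k}. of_int (c i i' * d j j') * v (i', j'))"
      by (rule sum.cartesian_product)
    finally show "a * b * v y = (\<Sum>z\<in>{..<m} \<times> {..<k}.
        of_int ((case y of (i, j) \<Rightarrow> \<lambda>(i', j'). c i i' * d j j') z) * v z)"
      by (simp add: y case_prod_unfold)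
  qed
  show "algebraic_int (a + b)"
  proof (rule algebraic_int_if_lattice_stable[where z = "(0, 0)" and v = v
        and c = "\<lambda>(i, j) (i', j'). c i i' * of_bool (j = j') + d j j' * of_bool (i = i')", OF S])
    fix y assume "y \<in> {..<m} \<times> {..<k}"
    then obtain i j where y: "y = (i, j)" and ij: "i < m" "j < k" by auto
    have "(\<Sum>i'<m. \<Sum>j'<k. of_int (c i i' * of_bool (j = j') + d j j' * of_bool (i = i')) * v (i', j'))
       = (\<Sum>i'<m. \<Sum>j'<k. if j = j' then of_int (c i i') * v (i', j') else 0)
       + (\<Sum>i'<m. \<Sum>j'<k. if i = i' then of_int (d j j') * v (i', j') else 0)"
      unfolding sum.distrib[symmetric] by (intro sum.cong refl) (simp add: algebra_simps)
    also have "(\<Sum>i'<m. \<Sum>j'<k. if j = j' then of_int (c i i') * v (i', j') else 0)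
        = (\<Sum>i'<m. of_int (c i i') * v (i', j))"
      using ij by simp
    also have "(\<Sum>i'<m. \<Sum>j'<k. if i = i' then of_int (d j j') * v (i', j') else 0)
        = (\<Sum>i'<m. if i = i' then \<Sum>j'<k. of_int (d j j') * v (i', j') else 0)"
      by (intro sum.cong refl) simp
    also have "\<dots> = (\<Sum>j'<k. of_int (d j j') * v (i, j'))" using ij by simp
    also have "(\<Sum>i'<m. of_int (c i i') * v (i', j)) = (a * a ^ i) * b ^ j"
      unfolding m(2)[OF ij(1)] sum_distrib_right by (simp add: v_def mult.assoc)
    also have "(\<Sum>j'<k. of_int (d j j') * v (i, j')) = a ^ i * (b * b ^ j)"
      unfolding k(2)[OF ij(2)] sum_distrib_left by (simp add: v_def mult_ac)
    also have "a * a ^ i * b ^ j + a ^ i * (b * b ^ j) = (a + b) * v (i, j)"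
      by (simp add: v_def algebra_simps)
    finally show "(a + b) * v y = (\<Sum>z\<in>{..<m} \<times> {..<k}.
        of_int ((case y of (i, j) \<Rightarrow> \<lambda>(i', j').
          c i i' * of_bool (j = j') + d j j' * of_bool (i = i')) z) * v z)"
      by (simp add: y sum.cartesian_product case_prod_unfold)
  qed
qed

lemma algebraic_int_diff:
  "algebraic_int a \<Longrightarrow> algebraic_int b \<Longrightarrow> algebraic_int (a - b :: 'a::field_char_0)"
  using algebraic_int_plus[of a "- b"] by simp

lemma algebraic_int_sum:
  fixes f :: "'i \<Rightarrow> 'a::field_char_0"
  shows "(\<And>i. i \<in> A \<Longrightarrow> algebraic_int (f i)) \<Longrightarrow> algebraic_int (sum f A)"
  by (induction A rule: infinite_finite_induct) (auto intro: algebraic_int_plus)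

lemma algebraic_int_sum_list:
  fixes xs :: "'a::field_char_0 list"
  shows "(\<And>x. x \<in> set xs \<Longrightarrow> algebraic_int x) \<Longrightarrow> algebraic_int (sum_list xs)"
  by (induction xs) (auto intro: algebraic_int_plus)

lemma algebraic_int_power:
  "algebraic_int (a :: 'a::field_char_0) \<Longrightarrow> algebraic_int (a ^ n)"
  by (induction n) (auto intro: algebraic_int_times)

text \<open>\<open>x\<close> is a root of X^l - X^k - y with y = \<open>x ^ l - x ^ k\<close>, which
  is monic with algebraic integer coefficients.\<close>

lemma algebraic_int_if_power_diff:
  fixes x :: "'a::field_char_0"
  assumes "algebraic_int (x ^ l - x ^ k)" "k < l"
  shows "algebraic_int x"
proof -
  obtain p where p: "lead_coeff p = 1" "\<forall>i. Polynomial.coeff p i \<in> \<int>" "poly p (x ^ l - x ^ k) = 0"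
    using assms(1) by (auto simp: algebraic_int.simps)
  show ?thesis
  proof (rule algebraic_int_root[OF assms(1)])
    show "poly (Polynomial.monom 1 l - Polynomial.monom 1 k) x = x ^ l - x ^ k" by (simp add: poly_monom)
    show "\<forall>i. Polynomial.coeff (Polynomial.monom 1 l - Polynomial.monom 1 k) i \<in> (\<int> :: 'a set)" by simp
    have "degree (Polynomial.monom 1 l - Polynomial.monom (1::'a) k) = l"
      using degree_add_eq_left[of "- Polynomial.monom 1 k" "Polynomial.monom (1::'a) l"] assms(2)
      by (simp add: degree_monom_eq)
    thus "lead_coeff (Polynomial.monom 1 l - Polynomial.monom (1::'a) k) = 1"
      "degree (Polynomial.monom 1 l - Polynomial.monom (1::'a) k) > 0"
      using assms(2) by auto
  qed
qed

section \<open>Trace and codifferent\<close>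

lemma common_denominator:
  fixes f :: "'i \<Rightarrow> rat"
  assumes "finite A"
  shows "\<exists>D>0::nat. \<forall>i\<in>A. of_nat D * f i \<in> \<int>"
  using assms
proof (induction A rule: finite_induct)
  case empty
  show ?case by (intro exI[of _ 1]) auto
next
  case (insert a A)
  then obtain D :: nat where D: "D > 0" "\<forall>i\<in>A. of_nat D * f i \<in> \<int>" by blast
  obtain p q where pq: "f a = of_int p / of_int q" "q > 0"
    by (metis quotient_of_div quotient_of_denom_pos surj_pair)
  have "of_nat (D * nat q) * f i \<in> \<int>" if "i \<in> insert a A" for i
  proof (cases "i = a")
    case True
    have "of_nat (D * nat q) * f i = of_nat D * (of_int q * f i)" using pq(2) by simp
    also have "of_int q * f i = of_int p" using pq True by simp
    also have "of_nat D * of_int p = (of_int (int D * p) :: rat)" by simp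
    finally have "of_nat (D * nat q) * f i = of_int (int D * p)" .
    thus ?thesis by (metis Ints_of_int)
  next
    case False
    hence "of_nat D * f i \<in> \<int>" using D(2) that by blast
    hence "of_nat (nat q) * (of_nat D * f i) \<in> \<int>" by (rule Ints_mult[OF Ints_of_nat])
    thus ?thesis by (simp add: mult_ac)
  qed
  thus ?case using D(1) pq(2) by (intro exI[of _ "D * nat q"]) auto
qed

section \<open>Matrix traces as sums of eigenvalues\<close>

text \<open>Exchanging the sums turns the trace of P B Q into that of B (Q P), and Q P = 1.\<close>

lemma similar_mat_trace:
  fixes A B :: "'a::comm_ring_1 mat"
  assumes "similar_mat_wit A B P Q" and A: "A \<in> carrier_mat n n"
  shows "(\<Sum>i<n. A $$ (i, i)) = (\<Sum>i<n. B $$ (i, i))"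
proof -
  note w = similar_mat_witD2[OF A assms(1)]
  have "A $$ (i, i) = (\<Sum>j<n. \<Sum>k<n. P $$ (i, j) * B $$ (j, k) * Q $$ (k, i))" if "i < n" for i
  proof -
    have "A $$ (i, i) = (\<Sum>j<n. P $$ (i, j) * (\<Sum>k<n. B $$ (j, k) * Q $$ (k, i)))"
      using that w(5-7) unfolding w(3) by (simp add: scalar_prod_def lessThan_atLeast0)
    also have "\<dots> = (\<Sum>j<n. \<Sum>k<n. P $$ (i, j) * B $$ (j, k) * Q $$ (k, i))"
      by (simp add: sum_distrib_left mult.assoc)
    finally show ?thesis .
  qed
  hence "(\<Sum>i<n. A $$ (i, i)) =
      (\<Sum>i<n. \<Sum>j<n. \<Sum>k<n. P $$ (i, j) * B $$ (j, k) * Q $$ (k, i))"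
    by simp
  also have "\<dots> = (\<Sum>j<n. \<Sum>i<n. \<Sum>k<n. P $$ (i, j) * B $$ (j, k) * Q $$ (k, i))"
    by (rule sum.swap)
  also have "\<dots> = (\<Sum>j<n. \<Sum>k<n. \<Sum>i<n. P $$ (i, j) * B $$ (j, k) * Q $$ (k, i))"
    by (intro sum.cong refl sum.swap)
  also have "\<dots> = (\<Sum>j<n. \<Sum>k<n. B $$ (j, k) * (Q * P) $$ (k, j))"
    using w(6,7) by (intro sum.cong refl)
      (simp add: scalar_prod_def lessThan_atLeast0 sum_distrib_left mult_ac)
  also have "\<dots> = (\<Sum>j<n. B $$ (j, j))"
    unfolding w(2) by (intro sum.cong refl) (simp add: sum.remove[of _ j for j] if_distrib cong: if_cong)
  finally show ?thesis .
qed

text \<open>A Schur triangular form of \<open>A\<close> carries the roots of the characteristic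
  polynomial on its diagonal. This reduces integrality of a trace to integrality of
  eigenvalues.\<close>

lemma trace_eq_sum_eigenvalues:
  fixes A :: "complex mat"
  assumes A: "A \<in> carrier_mat n n"
  obtains es where "\<And>e. e \<in> set es \<Longrightarrow> eigenvalue A e" "(\<Sum>i<n. A $$ (i, i)) = sum_list es"
proof -
  obtain es where es: "char_poly A = (\<Prod>e\<leftarrow>es. [:- e, 1:])" "length es = n"
    using char_poly_factorized[OF A] by auto
  obtain B P Q where BPQ: "schur_decomposition A es = (B, P, Q)" by (metis prod_cases3)
  note s = schur_decomposition[OF A es(1) BPQ]
  hence "(\<Sum>i<n. A $$ (i, i)) = (\<Sum>i<n. B $$ (i, i))" using similar_mat_trace[OF _ A] by blast
  also have "\<dots> = sum_list (diag_mat B)"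
    using similar_mat_witD2(5)[OF A conjunct1[OF s]] unfolding diag_mat_def
    by (simp add: interv_sum_list_conv_sum_set_nat lessThan_atLeast0)
  also have "\<dots> = sum_list es" using s by simp
  finally have "(\<Sum>i<n. A $$ (i, i)) = sum_list es" .
  moreover have "eigenvalue A e" if "e \<in> set es" for e
    unfolding eigenvalue_root_char_poly[OF A] es(1)
    using that by (auto simp: poly_prod_list prod_list_zero_iff o_def)
  ultimately show ?thesis by (intro that)
qed

section \<open>Coordinates over the rationals and integrality of the trace\<close>

text \<open>The choice term is the one inside \<open>field_trace\<close>, so the trace is by
  definition computed in this basis.\<close>

definition rat_basis :: "'a::field_char_0 set" where
  "rat_basis = (SOME B. rat_vs.independent B \<and> rat_vs.span B = UNIV)"

abbreviation rat_coord :: "'a::field_char_0 \<Rightarrow> 'a \<Rightarrow> rat" where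
  "rat_coord \<equiv> rat_vs.representation rat_basis"

lemma field_trace_eq: "field_trace x = (\<Sum>b\<in>rat_basis. rat_coord (x * b) b)"
  unfolding field_trace_def rat_basis_def Let_def ..

locale number_field_type =
  fixes ty :: "'a::field_char_0 itself"
  assumes nf: "number_field ty"
begin

lemma
  shows finite_rat_basis: "finite (rat_basis :: 'a set)"
    and independent_rat_basis: "rat_vs.independent (rat_basis :: 'a set)"
    and span_rat_basis: "rat_vs.span (rat_basis :: 'a set) = UNIV"
proof -
  obtain C :: "'a set" where C: "finite C" "rat_vs.span C = UNIV"
    using nf unfolding number_field_def by auto
  have "\<exists>B :: 'a set. rat_vs.independent B \<and> rat_vs.span B = UNIV"
    by (rule rat_vs.maximal_independent_subset[of UNIV]) auto
  from someI_ex[OF this] show B: "rat_vs.independent (rat_basis :: 'a set)"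
      "rat_vs.span (rat_basis :: 'a set) = UNIV"
    unfolding rat_basis_def by auto
  show "finite (rat_basis :: 'a set)"
    using rat_vs.independent_span_bound[OF C(1) B(1)] C(2) by auto
qed

lemma rat_coord_add: "rat_coord (x + y :: 'a) b = rat_coord x b + rat_coord y b"
  by (simp add: rat_vs.representation_add independent_rat_basis span_rat_basis)

lemma rat_coord_scale: "rat_coord (of_rat q * x :: 'a) b = q * rat_coord x b"
  using rat_vs.representation_scale[OF independent_rat_basis, of x q]
  by (simp add: span_rat_basis rat_scale_def)

lemma rat_coord_sum: "rat_coord (sum f A :: 'a) b = (\<Sum>i\<in>A. rat_coord (f i) b)"
  by (simp add: rat_vs.representation_sum independent_rat_basis span_rat_basis)

lemma rat_coord_basis:
  "c \<in> rat_basis \<Longrightarrow> rat_coord (c :: 'a) b = of_bool (b = c)"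
  by (simp add: rat_vs.representation_basis independent_rat_basis)

lemma rat_coord_expansion: "(\<Sum>b\<in>rat_basis. of_rat (rat_coord x b) * b) = (x :: 'a)"
  using rat_vs.sum_representation_eq[OF independent_rat_basis _ finite_rat_basis, of x]
  by (simp add: span_rat_basis rat_scale_def)

lemma rat_basis_nonempty: "(rat_basis :: 'a set) \<noteq> {}"
  using rat_coord_expansion[of 1] by auto

lemma rat_basis_nonzero: "b \<in> (rat_basis :: 'a set) \<Longrightarrow> b \<noteq> 0"
  using independent_rat_basis rat_vs.dependent_zero by blast

text \<open>If \<open>D\<close> clears the denominators of the matrix of multiplication by
  \<open>x\<close>, then \<open>D * x\<close> maps the integral span of the basis into
  itself.\<close>

lemma exists_integral_multiple: "\<exists>m>0::nat. algebraic_int (of_nat m * x :: 'a)"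
proof -
  let ?B = "rat_basis :: 'a set"
  obtain D :: nat where D: "D > 0"
      "\<forall>i\<in>?B \<times> ?B. of_nat D * (\<lambda>(b, c). rat_coord (x * b) c) i \<in> \<int>"
    using common_denominator[of "?B \<times> ?B"] finite_rat_basis by blast
  obtain b0 where b0: "b0 \<in> ?B" using rat_basis_nonempty by auto
  define k where "k b c = \<lfloor>of_nat D * rat_coord (x * b) c\<rfloor>" for b c
  have k: "of_int (k b c) = of_nat D * rat_coord (x * b) c" if "b \<in> ?B" "c \<in> ?B" for b c
    using D(2) that by (auto simp: k_def)
  have "algebraic_int (of_nat D * x)"
  proof (rule algebraic_int_if_lattice_stable[where z = b0 and v = id and c = k, OF finite_rat_basis b0])
    show "id b0 \<noteq> 0" using rat_basis_nonzero[OF b0] by simp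
    fix b assume b: "b \<in> ?B"
    have "of_nat D * x * id b = of_nat D * (\<Sum>c\<in>?B. of_rat (rat_coord (x * b) c) * c)"
      unfolding rat_coord_expansion by (simp add: mult_ac)
    also have "\<dots> = (\<Sum>c\<in>?B. of_rat (of_nat D * rat_coord (x * b) c) * c)"
      by (simp add: sum_distrib_left of_rat_mult mult_ac)
    also have "\<dots> = (\<Sum>c\<in>?B. of_int (k b c) * id c)"
      by (intro sum.cong refl) (simp add: k[OF b, symmetric])
    finally show "of_nat D * x * id b = (\<Sum>c\<in>?B. of_int (k b c) * id c)" .
  qed
  thus ?thesis using D(1) by auto
qed

text \<open>An eigenvector of the complex matrix of multiplication by \<open>y\<close> is a \<open>\<rat>\<close>-linear
  \<open>f : F \<rightarrow> \<complex>\<close> with \<open>f (y x) = \<lambda> f x\<close>, so \<open>\<lambda>\<close> is a root of every polynomial that kills \<open>y\<close>.\<close>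

lemma field_trace_integral:
  assumes y: "algebraic_int (y :: 'a)"
  shows "field_trace y \<in> \<int>"
proof -
  let ?B = "rat_basis :: 'a set"
  define n where "n = card ?B"
  obtain h where h: "bij_betw h {..<n} ?B"
    using ex_bij_betw_nat_finite[OF finite_rat_basis] unfolding n_def atLeast0LessThan by blast
  have hB: "h i \<in> ?B" if "i < n" for i using h that by (auto simp: bij_betw_def)
  \<comment> \<open>Row \<open>j\<close> holds the coordinates of \<open>y * h j\<close>, the
    transpose of the usual matrix, so that \<open>A u = e u\<close> says
    \<open>f (y * b) = e * f b\<close> on the basis.\<close>
  define A :: "complex mat" where "A = mat n n (\<lambda>(j, i). of_rat (rat_coord (y * h j) (h i)))"
  have A: "A \<in> carrier_mat n n" by (simp add: A_def)
  obtain p where p: "poly (map_poly of_int p) y = 0" "lead_coeff p = 1"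
    using y unfolding algebraic_int_altdef_ipoly by auto
  have integral: "algebraic_int e" if "eigenvalue A e" for e
  proof -
    obtain u where u: "u \<in> carrier_vec n" "u \<noteq> 0\<^sub>v n" "A *\<^sub>v u = e \<cdot>\<^sub>v u"
      using \<open>eigenvalue A e\<close> A unfolding eigenvalue_def eigenvector_def by auto
    define f :: "'a \<Rightarrow> complex" where "f x = (\<Sum>i<n. of_rat (rat_coord x (h i)) * u $ i)" for x
    have f_add: "f (x + z) = f x + f z" for x z
      by (simp add: f_def rat_coord_add of_rat_add sum.distrib algebra_simps)
    have f_scale: "f (of_rat q * x) = of_rat q * f x" for q x
      by (simp add: f_def rat_coord_scale of_rat_mult sum_distrib_left mult.assoc)
    have f_0: "f 0 = 0" using f_scale[of 0 0] by simp
    have f_sum: "f (sum g S) = (\<Sum>s\<in>S. f (g s))" for g :: "'c \<Rightarrow> 'a" and S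
      by (induction S rule: infinite_finite_induct) (auto simp: f_add f_0)
    have f_h: "f (h j) = u $ j" if "j < n" for j
    proof -
      have "f (h j) = (\<Sum>i<n. if i = j then u $ i else 0)"
        unfolding f_def
      proof (intro sum.cong refl)
        fix i assume "i \<in> {..<n}"
        hence "h i = h j \<longleftrightarrow> i = j" using h that by (auto simp: bij_betw_def inj_on_def)
        thus "of_rat (rat_coord (h j) (h i)) * u $ i = (if i = j then u $ i else 0)"
          by (simp add: rat_coord_basis hB that)
      qed
      thus ?thesis using that by simp
    qed
    have f_y_basis: "f (y * b) = e * f b" if b: "b \<in> ?B" for b
    proof -
      obtain j where j: "j < n" "b = h j" using h b by (auto simp: bij_betw_def)
      have "f (y * b) = (A *\<^sub>v u) $ j"
        using j u(1) by (simp add: f_def A_def scalar_prod_def lessThan_atLeast0)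
      also have "\<dots> = e * f b" using j u(1) by (simp add: u(3) f_h)
      finally show ?thesis .
    qed
    have f_y: "f (y * x) = e * f x" for x
    proof -
      have "f (y * x) = f (\<Sum>b\<in>?B. of_rat (rat_coord x b) * (y * b))"
        by (subst (1) rat_coord_expansion[of x, symmetric]) (simp add: sum_distrib_left mult_ac)
      also have "\<dots> = e * (\<Sum>b\<in>?B. of_rat (rat_coord x b) * f b)"
        unfolding f_sum f_scale sum_distrib_left
        by (intro sum.cong refl) (simp add: f_y_basis)
      also have "(\<Sum>b\<in>?B. of_rat (rat_coord x b) * f b) = f (\<Sum>b\<in>?B. of_rat (rat_coord x b) * b)"
        by (simp add: f_sum f_scale)
      finally show ?thesis by (simp add: rat_coord_expansion)
    qed
    have f_power: "f (y ^ k * x) = e ^ k * f x" for k x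
      by (induction k) (simp_all add: f_y mult.assoc)
    obtain j where j: "j < n" "u $ j \<noteq> 0"
      using u(1,2) by (metis carrier_vecD eq_vecI index_zero_vec(1,2))
    have "0 = f (poly (map_poly of_int p) y * h j)" by (simp add: p f_0)
    also have "\<dots> = f (\<Sum>i\<le>degree p. of_rat (of_int (Polynomial.coeff p i)) * (y ^ i * h j))"
      by (simp add: poly_altdef coeff_map_poly degree_map_poly sum_distrib_right mult.assoc)
    also have "\<dots> = (\<Sum>i\<le>degree p. of_int (Polynomial.coeff p i) * e ^ i) * u $ j"
      by (simp only: f_sum f_scale f_power f_h[OF j(1)]) (simp add: sum_distrib_right mult.assoc)
    also have "(\<Sum>i\<le>degree p. of_int (Polynomial.coeff p i) * e ^ i) = poly (map_poly of_int p) e"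
      by (simp add: poly_altdef coeff_map_poly degree_map_poly)
    finally have "poly (map_poly of_int p) e = 0" using j(2) by simp
    thus ?thesis using p(2) unfolding algebraic_int_altdef_ipoly by auto
  qed
  obtain es where es: "\<And>e. e \<in> set es \<Longrightarrow> eigenvalue A e" "(\<Sum>i<n. A $$ (i, i)) = sum_list es"
    using trace_eq_sum_eigenvalues[OF A] by blast
  have "of_rat (field_trace y) = (\<Sum>b\<in>?B. of_rat (rat_coord (y * b) b) :: complex)"
    by (simp add: field_trace_eq of_rat_sum)
  also have "\<dots> = (\<Sum>i<n. of_rat (rat_coord (y * h i) (h i)))"
    by (rule sum.reindex_bij_betw[OF h, symmetric])
  also have "\<dots> = sum_list es" by (simp add: A_def flip: es(2))
  finally have "of_rat (field_trace y) = sum_list es" .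
  moreover have "algebraic_int (sum_list es)"
    using es(1) integral by (intro algebraic_int_sum_list) auto
  ultimately have "(of_rat (field_trace y) :: complex) \<in> \<int>"
    by (metis Rats_of_rat rational_algebraic_int_is_int)
  then obtain k where "(of_rat (field_trace y) :: complex) = of_rat (of_int k)"
    by (auto elim!: Ints_cases)
  thus ?thesis by (simp del: of_rat_of_int_eq)
qed

section \<open>The trace form and the codifferent\<close>

lemma field_trace_add: "field_trace (x + y :: 'a) = field_trace x + field_trace y"
  by (simp add: field_trace_eq distrib_right rat_coord_add sum.distrib)

lemma field_trace_scale: "field_trace (of_rat q * x :: 'a) = q * field_trace x"
  by (simp add: field_trace_eq mult.assoc rat_coord_scale sum_distrib_left)

lemma field_trace_0: "field_trace (0 :: 'a) = 0"
  using field_trace_scale[of 0 0] by simp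

lemma field_trace_sum: "field_trace (sum f S :: 'a) = (\<Sum>s\<in>S. field_trace (f s))"
  by (induction S rule: infinite_finite_induct) (auto simp: field_trace_add field_trace_0)

lemma field_trace_1: "field_trace (1 :: 'a) \<noteq> 0"
  by (simp add: field_trace_eq rat_coord_basis finite_rat_basis rat_basis_nonempty)

text \<open>For nonzero \<open>x\<close>, the element 1 = x x^(-1) is a rational combination of the
  \<open>x * b\<close>, so its trace would vanish. But the trace of 1 is the number of basis
  elements.\<close>

lemma field_trace_nondegenerate:
  assumes "\<And>b. b \<in> rat_basis \<Longrightarrow> field_trace (x * b) = 0"
  shows "x = (0 :: 'a)"
proof (rule ccontr)
  assume "x \<noteq> 0"
  hence "1 = x * inverse x" by simp
  also have "\<dots> = (\<Sum>b\<in>rat_basis. of_rat (rat_coord (inverse x) b) * (x * b))"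
    by (subst (1) rat_coord_expansion[of "inverse x", symmetric]) (simp add: sum_distrib_left mult_ac)
  finally have "field_trace (1 :: 'a) =
      field_trace (\<Sum>b\<in>rat_basis. of_rat (rat_coord (inverse x) b) * (x * b))"
    by (rule arg_cong)
  also have "\<dots> = 0" by (simp only: field_trace_sum field_trace_scale assms) (simp add: assms)
  finally have "field_trace (1 :: 'a) = 0" .
  thus False using field_trace_1 by simp
qed

text \<open>\<open>c\<close> is the basis dual, under the trace form, to the integral basis formed
  by the \<open>of_nat d * b\<close>. Nondegeneracy makes the trace coordinates injective, hence
  bijective by finite dimension.\<close>

lemma codifferent_dual_basis:
  obtains d :: nat and c :: "'a \<Rightarrow> 'a" where "d > 0"
    "\<And>b :: 'a. b \<in> rat_basis \<Longrightarrow> algebraic_int (of_nat d * b)"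
    "\<And>x. x = (\<Sum>b\<in>rat_basis. of_rat (field_trace (x * (of_nat d * b))) * c b)"
proof -
  let ?B = "rat_basis :: 'a set"
  interpret fd: finite_dimensional_vector_space "rat_scale :: rat \<Rightarrow> 'a \<Rightarrow> 'a" ?B
    by unfold_locales (rule finite_rat_basis independent_rat_basis span_rat_basis)+
  obtain m where m: "\<And>b :: 'a. m b > (0::nat)" "\<And>b. algebraic_int (of_nat (m b) * b)"
    using exists_integral_multiple by metis
  define d where "d = (\<Prod>b\<in>?B. m b)"
  have d: "d > 0" using m(1) by (simp add: d_def prod_pos)
  have int: "algebraic_int (of_nat d * b)" if "b \<in> ?B" for b
  proof -
    have "of_nat d * b = of_nat (\<Prod>b\<in>?B - {b}. m b) * (of_nat (m b) * b)"
      unfolding d_def prod.remove[OF finite_rat_basis that] by (simp add: mult_ac)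
    thus ?thesis using m(2) by (metis algebraic_int_of_nat algebraic_int_times)
  qed
  \<comment> \<open>The vector of trace coordinates is stored as an element of the field itself, so
    that injectivity of this endomorphism yields surjectivity.\<close>
  define \<phi> where "\<phi> x = (\<Sum>b\<in>?B. of_rat (field_trace (x * (of_nat d * b))) * b)" for x
  have \<phi>: "\<phi> (x + y) = \<phi> x + \<phi> y" "\<phi> (of_rat q * x) = of_rat q * \<phi> x" for x y q
    by (simp_all add: \<phi>_def distrib_right field_trace_add of_rat_add sum.distrib mult.assoc
        field_trace_scale of_rat_mult sum_distrib_left)
  have lin: "Vector_Spaces.linear rat_scale rat_scale \<phi>"
    by (intro Vector_Spaces.linear.intro module_hom.intro module_hom_axioms.intro
        rat_vs.vector_space_axioms rat_vs.module_axioms) (simp_all add: \<phi> rat_scale_def)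
  interpret lin: Vector_Spaces.linear rat_scale rat_scale \<phi> by (rule lin)
  have "inj \<phi>"
    unfolding lin.inj_iff_eq_0
  proof (intro allI impI)
    fix x assume "\<phi> x = 0"
    have "field_trace (x * b) = 0" if b: "b \<in> ?B" for b
    proof -
      have "0 = rat_coord (\<phi> x) b" using \<open>\<phi> x = 0\<close> by (simp add: rat_vs.representation_zero)
      also have "\<dots> = (\<Sum>c\<in>?B. if c = b then field_trace (x * (of_nat d * c)) else 0)"
        unfolding \<phi>_def rat_coord_sum
        by (intro sum.cong refl) (simp add: rat_coord_scale rat_coord_basis)
      also have "\<dots> = field_trace (of_rat (of_nat d) * (x * b))"
        using b finite_rat_basis by (simp add: mult_ac)
      also have "\<dots> = of_nat d * field_trace (x * b)" by (rule field_trace_scale)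
      finally show ?thesis using d by simp
    qed
    thus "x = 0" by (rule field_trace_nondegenerate)
  qed
  hence "surj \<phi>" using fd.linear_inj_imp_surj[OF lin] by blast
  define c where "c = inv_into UNIV \<phi>"
  have \<phi>c: "\<phi> (c b) = b" for b unfolding c_def by (rule surj_f_inv_f[OF \<open>surj \<phi>\<close>])
  have "x = (\<Sum>b\<in>?B. of_rat (field_trace (x * (of_nat d * b))) * c b)" for x
  proof (rule injD[OF \<open>inj \<phi>\<close>])
    have "\<phi> (\<Sum>b\<in>?B. of_rat (field_trace (x * (of_nat d * b))) * c b)
        = (\<Sum>b\<in>?B. \<phi> (of_rat (field_trace (x * (of_nat d * b))) * c b))"
      by (rule lin.sum)
    also have "\<dots> = \<phi> x" by (simp add: \<phi> \<phi>c) (simp add: \<phi>_def)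
    finally show "\<phi> x = \<phi> (\<Sum>b\<in>?B. of_rat (field_trace (x * (of_nat d * b))) * c b)" ..
  qed
  with d int show ?thesis by (rule that)
qed

text \<open>For \<open>x\<close> in the codifferent the trace coordinates against the integral
  elements \<open>of_nat d * b\<close> are integers; \<open>k\<close> reads them off with a floor,
  which changes nothing here. \<open>N\<close> is a common denominator of the dual basis.\<close>

lemma codifferent_lattice:
  obtains c :: "'a \<Rightarrow> 'a" and N :: nat and k :: "'a \<Rightarrow> 'a \<Rightarrow> int" where "N > 0"
    "\<And>b. b \<in> rat_basis \<Longrightarrow> algebraic_int (of_nat N * c b)"
    "\<And>x. x \<in> codifferent \<Longrightarrow> x = (\<Sum>b\<in>rat_basis. of_int (k x b) * c b)"
proof -
  let ?B = "rat_basis :: 'a set"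
  obtain d :: nat and c :: "'a \<Rightarrow> 'a" where dc: "d > 0"
    "\<And>b :: 'a. b \<in> ?B \<Longrightarrow> algebraic_int (of_nat d * b)"
    "\<And>x. x = (\<Sum>b\<in>?B. of_rat (field_trace (x * (of_nat d * b))) * c b)"
    by (rule codifferent_dual_basis) (rule that, assumption+)
  obtain m where m: "\<And>x :: 'a. m x > (0::nat)" "\<And>x. algebraic_int (of_nat (m x) * x)"
    using exists_integral_multiple by metis
  define N where "N = (\<Prod>b\<in>?B. m (c b))"
  have "N > 0" using m(1) by (simp add: N_def prod_pos)
  moreover have "algebraic_int (of_nat N * c b)" if "b \<in> ?B" for b
  proof -
    have "of_nat N * c b = of_nat (\<Prod>b\<in>?B - {b}. m (c b)) * (of_nat (m (c b)) * c b)"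
      unfolding N_def prod.remove[OF finite_rat_basis that] by (simp add: mult_ac)
    thus ?thesis using m(2) by (metis algebraic_int_of_nat algebraic_int_times)
  qed
  moreover have "x = (\<Sum>b\<in>?B. of_int \<lfloor>field_trace (x * (of_nat d * b))\<rfloor> * c b)"
    if x: "x \<in> codifferent" for x
  proof -
    have "of_rat (field_trace (x * (of_nat d * b))) = (of_int \<lfloor>field_trace (x * (of_nat d * b))\<rfloor> :: 'a)"
      if "b \<in> ?B" for b
    proof -
      have "field_trace (x * (of_nat d * b)) \<in> \<int>"
        using x dc(2)[OF that] unfolding codifferent_def by blast
      thus ?thesis by (metis Ints_cases floor_of_int of_rat_of_int_eq)
    qed
    thus ?thesis by (subst (1) dc(3)[of x]) simp
  qed
  ultimately show ?thesis by (rule that)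
qed

lemma algebraic_int_in_codifferent: "algebraic_int (x :: 'a) \<Longrightarrow> x \<in> codifferent"
  unfolding codifferent_def using field_trace_integral algebraic_int_times by blast

lemma fractional_ideal_codifferent: "fractional_ideal (codifferent :: 'a set)"
proof -
  obtain c :: "'a \<Rightarrow> 'a" and N :: nat and k :: "'a \<Rightarrow> 'a \<Rightarrow> int" where cN: "N > 0"
    "\<And>b. b \<in> rat_basis \<Longrightarrow> algebraic_int (of_nat N * c b)"
    "\<And>x. x \<in> codifferent \<Longrightarrow> x = (\<Sum>b\<in>rat_basis. of_int (k x b) * c b)"
    by (rule codifferent_lattice) (rule that, assumption+)
  have "algebraic_int (of_nat N * x)" if "x \<in> codifferent" for x :: 'a
  proof -
    have "of_nat N * x = (\<Sum>b\<in>rat_basis. of_int (k x b) * (of_nat N * c b))"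
      by (subst (1) cN(3)[OF that]) (simp add: sum_distrib_left mult_ac)
    also have "algebraic_int \<dots>"
      by (intro algebraic_int_sum algebraic_int_times cN(2)) auto
    finally show ?thesis .
  qed
  moreover have "(0 :: 'a) \<in> codifferent" "(codifferent :: 'a set) \<noteq> {0}"
    using algebraic_int_in_codifferent[of 0] algebraic_int_in_codifferent[of 1]
    by (simp, metis algebraic_int_1 singletonD zero_neq_one)
  moreover have "x + y \<in> codifferent" if "x \<in> codifferent" "y \<in> codifferent" for x y :: 'a
    using that by (auto simp: codifferent_def distrib_right field_trace_add)
  moreover have "a * x \<in> codifferent" if "algebraic_int a" "x \<in> codifferent" for a x :: 'a
    unfolding codifferent_def
  proof (safe)
    fix y :: 'a assume "algebraic_int y"
    hence "field_trace (x * (a * y)) \<in> \<int>"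
      using that algebraic_int_times unfolding codifferent_def by blast
    thus "field_trace (a * x * y) \<in> \<int>" by (simp add: mult_ac)
  qed
  ultimately show ?thesis
    unfolding fractional_ideal_def using cN(1)
    by (intro conjI ballI allI impI exI[of _ "of_nat N"]) auto
qed

section \<open>Finiteness of O/mO\<close>

text \<open>O lies in the codifferent, so every algebraic integer has integral coordinates in the
  dual basis. There are finitely many coordinate vectors modulo \<open>m * N\<close>, and they
  determine the class modulo \<open>m\<close>.\<close>

lemma finite_residues:
  assumes "m > (0::nat)"
  obtains S :: "'a set" where "finite S" "\<And>s. s \<in> S \<Longrightarrow> algebraic_int s"
    "\<And>x. algebraic_int x \<Longrightarrow> \<exists>s\<in>S. \<exists>y. algebraic_int y \<and> x = s + of_nat m * y"
proof -
  let ?B = "rat_basis :: 'a set" and ?O = "{x :: 'a. algebraic_int x}"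
  obtain c :: "'a \<Rightarrow> 'a" and N :: nat and k :: "'a \<Rightarrow> 'a \<Rightarrow> int" where cN: "N > 0"
    "\<And>b. b \<in> rat_basis \<Longrightarrow> algebraic_int (of_nat N * c b)"
    "\<And>x. x \<in> codifferent \<Longrightarrow> x = (\<Sum>b\<in>rat_basis. of_int (k x b) * c b)"
    by (rule codifferent_lattice) (rule that, assumption+)
  \<comment> \<open>The modulus is \<open>m * N\<close> and not \<open>m\<close>: the elements
    \<open>c b\<close> may fail to be integral, while \<open>of_nat N * c b\<close> is
    integral.\<close>
  define key where "key x = (\<lambda>b\<in>?B. k x b mod (int m * int N))" for x
  \<comment> \<open>One algebraic integer is chosen for each key that is attained.\<close>
  define S where "S = (\<lambda>t. SOME x. x \<in> ?O \<and> key x = t) ` (key ` ?O)"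
  have "key ` ?O \<subseteq> PiE ?B (\<lambda>_. {0..<int m * int N})"
    using assms cN(1) by (auto simp: key_def)
  hence "finite (key ` ?O)"
    by (rule finite_subset) (auto intro!: finite_PiE finite_rat_basis)
  hence "finite S" unfolding S_def by blast
  have pick: "(SOME z. z \<in> ?O \<and> key z = key x) \<in> ?O \<and> key (SOME z. z \<in> ?O \<and> key z = key x) = key x"
    if "x \<in> ?O" for x
    using that by (intro someI[of "\<lambda>z. z \<in> ?O \<and> key z = key x"]) auto
  show ?thesis
  proof (rule that[OF \<open>finite S\<close>])
    show "algebraic_int s" if "s \<in> S" for s using that pick by (auto simp: S_def)
    fix x :: 'a assume x: "algebraic_int x"
    define s where "s = (SOME z. z \<in> ?O \<and> key z = key x)"
    have s: "s \<in> S" "algebraic_int s" "key s = key x"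
      using x pick unfolding s_def S_def by auto
    define y where "y = (\<Sum>b\<in>?B. of_int ((k x b - k s b) div (int m * int N)) * (of_nat N * c b))"
    have "algebraic_int y"
      unfolding y_def by (intro algebraic_int_sum algebraic_int_times cN(2)) auto
    have "x - s = (\<Sum>b\<in>?B. of_int (k x b) * c b) - (\<Sum>b\<in>?B. of_int (k s b) * c b)"
      using cN(3)[OF algebraic_int_in_codifferent[OF x]]
        cN(3)[OF algebraic_int_in_codifferent[OF s(2)]] by simp
    also have "\<dots> = (\<Sum>b\<in>?B. of_int (k x b - k s b) * c b)"
      by (simp add: sum_subtractf algebra_simps)
    also have "\<dots> = of_nat m * y"
      unfolding y_def sum_distrib_left
    proof (intro sum.cong refl)
      fix b assume b: "b \<in> ?B"
      have "k x b mod (int m * int N) = k s b mod (int m * int N)"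
        using s(3) b by (metis key_def restrict_apply')
      hence "int m * int N dvd k x b - k s b" by (simp add: mod_eq_dvd_iff)
      hence "k x b - k s b = int m * int N * ((k x b - k s b) div (int m * int N))" by simp
      hence "(of_int (k x b - k s b) :: 'a) =
          of_int (int m * int N * ((k x b - k s b) div (int m * int N)))" by (rule arg_cong)
      thus "of_int (k x b - k s b) * c b =
          of_nat m * (of_int ((k x b - k s b) div (int m * int N)) * (of_nat N * c b))"
        by (simp only: of_int_mult of_int_of_nat_eq mult_ac)
    qed
    finally have "x = s + of_nat m * y" by (simp add: algebra_simps)
    with \<open>algebraic_int y\<close> s(1) show "\<exists>s\<in>S. \<exists>y. algebraic_int y \<and> x = s + of_nat m * y" by blast
  qed
qed

end

section \<open>Invertibility of fractional ideals\<close>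

lemma ideal_mult_mem:
  assumes "x \<in> I" "y \<in> J"
  shows "x * y \<in> ideal_mult I J"
  unfolding ideal_mult_def using assms
  by (intro CollectI exI[of _ "1::nat"] exI[of _ "\<lambda>_. x"] exI[of _ "\<lambda>_. y"]) simp

lemma zero_in_ideal_mult: "0 \<in> ideal_mult I J"
  unfolding ideal_mult_def
  by (intro CollectI exI[of _ "0::nat"] exI[of _ "\<lambda>_. 0"]) simp

lemma ideal_mult_commute: "ideal_mult I J = ideal_mult J I"
  unfolding ideal_mult_def by (subst mult.commute) blast

lemma ideal_mult_add_mult:
  assumes "z \<in> ideal_mult I J" "x \<in> I" "y \<in> J"
  shows "z + x * y \<in> ideal_mult I J"
proof -
  obtain k :: nat and f g where z: "z = (\<Sum>i<k. f i * g i)" "\<forall>i<k. f i \<in> I" "\<forall>i<k. g i \<in> J"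
    using assms(1) unfolding ideal_mult_def by blast
  let ?f = "f(k := x)" and ?g = "g(k := y)"
  have "z + x * y = (\<Sum>i<Suc k. ?f i * ?g i)"
    using z(1) by simp
  moreover have "\<forall>i<Suc k. ?f i \<in> I" "\<forall>i<Suc k. ?g i \<in> J"
    using z(2,3) assms(2,3) by (auto simp: less_Suc_eq)
  ultimately show ?thesis unfolding ideal_mult_def by blast
qed

text \<open>Adds one product at a time, so that later proofs need not handle indexed sums.\<close>

lemma ideal_mult_induct [consumes 1, case_names zero add]:
  assumes "z \<in> ideal_mult I J"
    and "P 0" "\<And>w x y. P w \<Longrightarrow> x \<in> I \<Longrightarrow> y \<in> J \<Longrightarrow> P (w + x * y)"
  shows "P z"
proof -
  obtain k :: nat and f g where z: "z = (\<Sum>i<k. f i * g i)" "\<forall>i<k. f i \<in> I" "\<forall>i<k. g i \<in> J"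
    using assms(1) unfolding ideal_mult_def by blast
  have "P (\<Sum>i<l. f i * g i)" if "l \<le> k" for l
    using that z(2,3) assms(2,3) by (induction l) auto
  thus ?thesis using z(1) by simp
qed

lemma ideal_mult_add:
  assumes "w \<in> ideal_mult I J" "z \<in> ideal_mult I J"
  shows "z + w \<in> ideal_mult I J"
proof -
  from assms(1) have "z + w \<in> ideal_mult I J"
  proof (induction w rule: ideal_mult_induct)
    case zero
    show ?case using assms(2) by simp
  next
    case (add w x y)
    thus ?case using ideal_mult_add_mult[of "z + w" I J x y] by (simp add: add.assoc)
  qed
  thus ?thesis .
qed

lemma ideal_mult_subset:
  assumes "0 \<in> K" "\<And>x y. x \<in> K \<Longrightarrow> y \<in> K \<Longrightarrow> x + y \<in> K"
    and "\<And>x y. x \<in> I \<Longrightarrow> y \<in> J \<Longrightarrow> x * y \<in> K"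
  shows "ideal_mult I J \<subseteq> K"
proof
  fix z assume "z \<in> ideal_mult I J"
  thus "z \<in> K" by (induction rule: ideal_mult_induct) (auto simp: assms)
qed

lemma ideal_mult_assoc_subset:
  "ideal_mult (ideal_mult I J) K \<subseteq> ideal_mult I (ideal_mult J K)"
proof (rule ideal_mult_subset)
  fix u k assume u: "u \<in> ideal_mult I J" and k: "k \<in> K"
  from u show "u * k \<in> ideal_mult I (ideal_mult J K)"
  proof (induction rule: ideal_mult_induct)
    case zero
    show ?case by (simp add: zero_in_ideal_mult)
  next
    case (add w x y)
    thus ?case using ideal_mult_add_mult[of "w * k" I "ideal_mult J K" x "y * k"] k
      by (simp add: distrib_right mult.assoc ideal_mult_mem)
  qed
qed (auto simp: zero_in_ideal_mult ideal_mult_add)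

text \<open>By commutativity, the reverse inclusion is the same one with \<open>I\<close> and
  \<open>K\<close> exchanged.\<close>

lemma ideal_mult_assoc: "ideal_mult (ideal_mult I J) K = ideal_mult I (ideal_mult J K)"
  using ideal_mult_assoc_subset[of I J K] ideal_mult_assoc_subset[of K J I]
  by (simp add: ideal_mult_commute)

lemma fractional_ideal_mult:
  assumes I: "fractional_ideal I" and J: "fractional_ideal J"
  shows "fractional_ideal (ideal_mult I J)"
proof -
  obtain x where x: "x \<in> I" "x \<noteq> 0" using I unfolding fractional_ideal_def by blast
  obtain y where y: "y \<in> J" "y \<noteq> 0" using J unfolding fractional_ideal_def by blast
  have "x * y \<noteq> 0" "x * y \<in> ideal_mult I J" using x y by (simp_all add: ideal_mult_mem)
  hence "ideal_mult I J \<noteq> {0}" by (metis singletonD)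
  moreover have "a * z \<in> ideal_mult I J" if "algebraic_int a" "z \<in> ideal_mult I J" for a z
    using that(2)
  proof (induction rule: ideal_mult_induct)
    case zero
    show ?case by (simp add: zero_in_ideal_mult)
  next
    case (add w x y)
    moreover have "a * x \<in> I" using I that(1) add unfolding fractional_ideal_def by blast
    ultimately show ?case using ideal_mult_add_mult[of "a * w" I J "a * x" y]
      by (simp add: distrib_left mult.assoc)
  qed
  moreover obtain d where d: "d \<noteq> 0" "algebraic_int d" "\<forall>x\<in>I. algebraic_int (d * x)"
    using I unfolding fractional_ideal_def by blast
  moreover obtain e where e: "e \<noteq> 0" "algebraic_int e" "\<forall>x\<in>J. algebraic_int (e * x)"
    using J unfolding fractional_ideal_def by blast
  moreover have "algebraic_int (d * e * z)" if "z \<in> ideal_mult I J" for z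
    using that
  proof (induction rule: ideal_mult_induct)
    case (add w x y)
    moreover have "algebraic_int ((d * x) * (e * y))"
      by (rule algebraic_int_times) (use add d(3) e(3) in auto)
    ultimately have "algebraic_int (d * e * w + (d * x) * (e * y))"
      by (intro algebraic_int_plus) auto
    thus ?case by (simp add: distrib_left mult_ac)
  qed simp
  ultimately show ?thesis
    unfolding fractional_ideal_def
    by (intro conjI ballI allI impI exI[of _ "d * e"])
      (auto simp: zero_in_ideal_mult ideal_mult_add intro: algebraic_int_times)
qed

definition ideal_inverse :: "'a::field_char_0 set \<Rightarrow> 'a set" where
  "ideal_inverse I = {x. \<forall>y\<in>I. algebraic_int (x * y)}"

context number_field_type
begin

section \<open>Annihilators modulo m and invertibility\<close>

text \<open>Clears the denominator of the inverse of \<open>c\<close>. It puts a positive integer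
  into every ideal that contains \<open>c\<close>, which gives access to the finite ring
  O/mO.\<close>

lemma exists_integral_cofactor:
  assumes "c \<noteq> (0 :: 'a)"
  obtains m :: nat and c' where "m > 0" "algebraic_int c'" "of_nat m = c' * c"
proof -
  obtain m :: nat where "m > 0" "algebraic_int (of_nat m * inverse c)"
    using exists_integral_multiple by blast
  thus ?thesis using assms by (intro that[of m "of_nat m * inverse c"]) auto
qed

text \<open>Pigeonhole over the finitely many residues modulo \<open>m\<close>. The congruence is
  stated as integrality of a quotient, the form in which it is used in the field.\<close>

lemma exists_congruent_pair:
  assumes "m > (0::nat)" and f: "\<And>k::nat. algebraic_int (f k :: 'a)"
  obtains k l where "k < l" "algebraic_int ((f l - f k) / of_nat m)"
proof -
  obtain S :: "'a set" where S: "finite S"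
    "\<And>x. algebraic_int x \<Longrightarrow> \<exists>s\<in>S. \<exists>y. algebraic_int y \<and> x = s + of_nat m * y"
    using finite_residues[OF assms(1)] by metis
  obtain g h where gh: "\<And>k. g k \<in> S" "\<And>k. algebraic_int (h k)" "\<And>k. f k = g k + of_nat m * h k"
    using S(2)[OF f] by metis
  have "\<not> inj g"
    using S(1) gh(1) by (metis finite_subset image_subsetI range_inj_infinite)
  then obtain a b where ab: "g a = g b" "a \<noteq> b" by (auto simp: inj_def)
  define k l where "k = min a b" and "l = max a b"
  have "k < l" "g k = g l" using ab by (auto simp: k_def l_def min_def max_def)
  hence "(f l - f k) / of_nat m = h l - h k"
    using assms(1) by (simp add: gh(3) field_simps)
  thus ?thesis using \<open>k < l\<close> gh(2) by (intro that[of k l]) (auto intro: algebraic_int_diff)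
qed

text \<open>In the finite ring \<open>O/mO\<close> every \<open>t \<in> J\<close> satisfies \<open>t\<^sup>k (1 - t\<^bsup>l-k\<^esup>) = 0\<close> for some
  \<open>k < l\<close>. The product of the factors \<open>1 - t\<^bsup>l-k\<^esup>\<close> lies in \<open>1 + J\<close>, hence is nonzero, and a power of
  each \<open>t\<close> annihilates it.\<close>

lemma exists_power_annihilator:
  assumes "m > (0::nat)"
    and J: "\<And>x y. x \<in> J \<Longrightarrow> y \<in> J \<Longrightarrow> x + y \<in> J"
      "\<And>a x. algebraic_int a \<Longrightarrow> x \<in> J \<Longrightarrow> a * x \<in> J"
      "\<And>x. x \<in> J \<Longrightarrow> algebraic_int (x :: 'a)" "0 \<in> J"
    and T: "finite T" "T \<subseteq> J"
  shows "\<exists>u. algebraic_int u \<and> u - 1 \<in> J \<and> (\<forall>t\<in>T. \<exists>k. algebraic_int (u * t ^ k / of_nat m))"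
  using T
proof (induction T rule: finite_induct)
  case empty
  show ?case using J(4) by (intro exI[of _ 1]) auto
next
  case (insert t T)
  then obtain u where u: "algebraic_int u" "u - 1 \<in> J"
      "\<And>s. s \<in> T \<Longrightarrow> \<exists>k. algebraic_int (u * s ^ k / of_nat m)"
    by auto
  have t: "t \<in> J" "algebraic_int t" using insert J(3) by auto
  obtain k l where kl: "k < l" "algebraic_int ((t ^ l - t ^ k) / of_nat m)"
    using exists_congruent_pair[OF assms(1), of "\<lambda>k. t ^ k"] t(2) algebraic_int_power by blast
  define c where "c = 1 - t ^ (l - k)"
  have c: "algebraic_int c"
    unfolding c_def using t(2) by (intro algebraic_int_diff algebraic_int_power) auto
  have "t ^ k * c = - (t ^ l - t ^ k)"
    using kl(1) by (simp add: c_def algebra_simps flip: power_add)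
  hence tc: "u * c * t ^ k / of_nat m = (- u) * ((t ^ l - t ^ k) / of_nat m)"
    by (metis (no_types, lifting) mult.assoc mult.commute mult_minus_left mult_minus_right times_divide_eq_right)
  \<comment> \<open>As \<open>l - k\<close> is positive, \<open>t ^ (l - k)\<close> is a multiple of
    \<open>t\<close> and lies in \<open>J\<close>; hence the new product \<open>u * c\<close> is
    still congruent to 1 modulo \<open>J\<close>.\<close>
  have "t ^ (l - k) = t ^ (l - k - 1) * t" using kl(1) by (cases "l - k") (auto simp: mult.commute)
  hence "(- u * t ^ (l - k - 1)) * t = - u * t ^ (l - k)" by simp
  moreover have "(- u * t ^ (l - k - 1)) * t \<in> J"
    using u(1) t by (intro J(2) algebraic_int_times algebraic_int_power) auto
  ultimately have "(u - 1) + (- u * t ^ (l - k)) \<in> J" using J(1)[OF u(2)] by metis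
  hence "u * c - 1 \<in> J" by (simp add: c_def algebra_simps)
  moreover have "algebraic_int (u * c)" using u(1) c by (rule algebraic_int_times)
  moreover have "\<exists>k. algebraic_int (u * c * s ^ k / of_nat m)" if s: "s \<in> insert t T" for s
  proof (cases "s = t")
    case True
    have "algebraic_int ((- u) * ((t ^ l - t ^ k) / of_nat m))"
      using u(1) kl(2) by (intro algebraic_int_times) auto
    thus ?thesis using True tc by metis
  next
    case False
    then obtain k' where "algebraic_int (u * s ^ k' / of_nat m)" using s u(3)[of s] by auto
    hence "algebraic_int (c * (u * s ^ k' / of_nat m))" using c by (intro algebraic_int_times)
    moreover have "c * (u * s ^ k' / of_nat m) = u * c * s ^ k' / of_nat m" by simp
    ultimately show ?thesis by metis
  qed
  ultimately show ?case by blast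
qed

text \<open>Modulo \<open>m\<close>, the element \<open>u\<close> is nonzero and each
  \<open>t\<close> acts nilpotently on it. Multiplying \<open>u\<close> by the highest power of
  \<open>t\<close> that keeps it nonzero gives an element killed by \<open>t\<close>, and further
  factors preserve this. So \<open>r\<close> is a monomial in the elements of
  \<open>T\<close>.\<close>

lemma exists_annihilator_multiple:
  assumes "finite T" "\<And>t. t \<in> T \<Longrightarrow> algebraic_int t"
    and "algebraic_int u" "\<not> algebraic_int (u / of_nat m :: 'a)"
    and "\<And>t. t \<in> T \<Longrightarrow> \<exists>k. algebraic_int (u * t ^ k / of_nat m)"
  shows "\<exists>r. algebraic_int r \<and> \<not> algebraic_int (u * r / of_nat m) \<and>
    (\<forall>t\<in>T. algebraic_int (u * r * t / of_nat m))"
  using assms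
proof (induction T arbitrary: u rule: finite_induct)
  case empty
  thus ?case by (intro exI[of _ 1]) auto
next
  case (insert t T)
  have t: "algebraic_int t" using insert by simp
  \<comment> \<open>\<open>k\<close> is positive because \<open>u\<close> itself is nonzero modulo
    \<open>m\<close>, so its predecessor is the last exponent with a nonzero product.\<close>
  define k where "k = (LEAST k. algebraic_int (u * t ^ k / of_nat m))"
  have k: "algebraic_int (u * t ^ k / of_nat m)"
    unfolding k_def using insert.prems(4) by (metis LeastI_ex insertI1)
  hence "k \<noteq> 0" using insert.prems(3) by (cases k) auto
  then obtain k' where k': "k = Suc k'" by (cases k) auto
  hence nk': "\<not> algebraic_int (u * t ^ k' / of_nat m)"
    using not_less_Least[of k' "\<lambda>k. algebraic_int (u * t ^ k / of_nat m)"] by (auto simp: k_def)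
  have "\<exists>j. algebraic_int (u * t ^ k' * s ^ j / of_nat m)" if s: "s \<in> T" for s
  proof -
    obtain j where "algebraic_int (u * s ^ j / of_nat m)" using insert.prems(4)[of s] s by auto
    hence "algebraic_int (t ^ k' * (u * s ^ j / of_nat m))"
      using t by (intro algebraic_int_times algebraic_int_power)
    moreover have "t ^ k' * (u * s ^ j / of_nat m) = u * t ^ k' * s ^ j / of_nat m" by simp
    ultimately show ?thesis by metis
  qed
  moreover have "algebraic_int (u * t ^ k')"
    using t insert.prems(2) by (intro algebraic_int_times algebraic_int_power)
  ultimately obtain r where r: "algebraic_int r" "\<not> algebraic_int (u * t ^ k' * r / of_nat m)"
      "\<forall>s\<in>T. algebraic_int (u * t ^ k' * r * s / of_nat m)"
    using insert.IH[of "u * t ^ k'"] insert.prems(1) nk' by auto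
  have "algebraic_int (r * (u * t ^ k / of_nat m))" using r(1) k by (rule algebraic_int_times)
  hence "algebraic_int (u * (t ^ k' * r) * t / of_nat m)" by (simp add: k' mult_ac)
  moreover have "algebraic_int (t ^ k' * r)"
    using t r(1) by (intro algebraic_int_times algebraic_int_power)
  ultimately show ?case using r(2,3) by (intro exI[of _ "t ^ k' * r"]) (auto simp: mult.assoc)
qed

text \<open>The witness is \<open>u * r / of_nat m\<close>, where \<open>u * r\<close> is nonzero
  modulo \<open>m\<close> and annihilated there by the image of \<open>J\<close>. The integer
  \<open>m\<close> is taken in \<open>J\<close>, so finitely many representatives suffice.\<close>

lemma exists_nonintegral_multiplier:
  assumes J: "\<And>x y. x \<in> J \<Longrightarrow> y \<in> J \<Longrightarrow> x + y \<in> J"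
      "\<And>a x. algebraic_int a \<Longrightarrow> x \<in> J \<Longrightarrow> a * x \<in> J"
      "\<And>x. x \<in> J \<Longrightarrow> algebraic_int (x :: 'a)" "0 \<in> J"
    and "J \<noteq> {0}" "1 \<notin> J"
  obtains x where "\<not> algebraic_int x" "\<And>j. j \<in> J \<Longrightarrow> algebraic_int (x * j)"
proof -
  obtain c where c: "c \<in> J" "c \<noteq> 0" using assms(4,5) by blast
  obtain m :: nat and c' where m: "m > 0" "algebraic_int c'" "of_nat m = c' * c"
    using exists_integral_cofactor[OF c(2)] by blast
  have mJ: "of_nat m \<in> J" unfolding m(3) using m(2) c(1) by (rule J(2))
  obtain S :: "'a set" where S: "finite S"
    "\<And>x. algebraic_int x \<Longrightarrow> \<exists>s\<in>S. \<exists>y. algebraic_int y \<and> x = s + of_nat m * y"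
    using finite_residues[OF m(1)] by metis
  obtain u where u: "algebraic_int u" "u - 1 \<in> J"
      "\<And>t. t \<in> S \<inter> J \<Longrightarrow> \<exists>k. algebraic_int (u * t ^ k / of_nat m)"
    using exists_power_annihilator[OF m(1) J, of "S \<inter> J"] S(1) by auto
  \<comment> \<open>If \<open>m\<close> divided \<open>u\<close>, then \<open>u\<close> would lie in
    \<open>J\<close>, and so would 1 = u - (u - 1).\<close>
  have "\<not> algebraic_int (u / of_nat m)"
  proof
    assume "algebraic_int (u / of_nat m)"
    hence "u / of_nat m * of_nat m \<in> J" using mJ by (rule J(2))
    hence "u + (-1) * (u - 1) \<in> J" using m(1) u(2) by (intro J(1,2)) auto
    thus False using \<open>1 \<notin> J\<close> by simp
  qed
  then obtain r where r: "algebraic_int r" "\<not> algebraic_int (u * r / of_nat m)"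
      "\<And>t. t \<in> S \<inter> J \<Longrightarrow> algebraic_int (u * r * t / of_nat m)"
    using exists_annihilator_multiple[of "S \<inter> J" u m] S(1) u(1,3) J(3) by auto
  show ?thesis
  proof (rule that[OF r(2)])
    fix j assume j: "j \<in> J"
    obtain s y where sy: "s \<in> S" "algebraic_int y" "j = s + of_nat m * y"
      using S(2)[OF J(3)[OF j]] by blast
    \<comment> \<open>The representative of \<open>j\<close> lies in \<open>J\<close> because
      \<open>m\<close> does, so the annihilation property applies to it.\<close>
    have "s = j + (- y) * of_nat m" using sy(3) by simp
    also have "\<dots> \<in> J" using j mJ sy(2) by (intro J(1,2)) auto
    finally have "algebraic_int (u * r * s / of_nat m)" using r(3) sy(1) by blast
    moreover have "algebraic_int (u * r * y)" using u(1) r(1) sy(2) by (intro algebraic_int_times)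
    moreover have "u * r / of_nat m * j = u * r * s / of_nat m + u * r * y"
      using m(1) by (simp add: sy(3) field_simps)
    ultimately show "algebraic_int (u * r / of_nat m * j)" by (metis algebraic_int_plus)
  qed
qed

lemma ideal_inverse_mult:
  assumes I: "fractional_ideal (I :: 'a set)"
  shows "ideal_mult (ideal_inverse I) I = {x. algebraic_int x}"
proof -
  define J where "J = ideal_mult (ideal_inverse I) I"
  have inv_mult: "a * z \<in> ideal_inverse I" if "algebraic_int a" "z \<in> ideal_inverse I" for a z
    using that by (auto simp: ideal_inverse_def mult.assoc intro: algebraic_int_times)
  have JO: "algebraic_int x" if "x \<in> J" for x
    using that unfolding J_def
    by (induction rule: ideal_mult_induct) (auto simp: ideal_inverse_def intro: algebraic_int_plus)
  have Jadd: "x + y \<in> J" if "x \<in> J" "y \<in> J" for x y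
    using that unfolding J_def by (simp add: ideal_mult_add)
  have J0: "0 \<in> J" unfolding J_def by (rule zero_in_ideal_mult)
  have Jmult: "a * x \<in> J" if "algebraic_int a" "x \<in> J" for a x
    using that(2) unfolding J_def
  proof (induction rule: ideal_mult_induct)
    case zero
    show ?case by (simp add: zero_in_ideal_mult)
  next
    case (add w x y)
    thus ?case using ideal_mult_add_mult[of "a * w" "ideal_inverse I" I "a * x" y]
        inv_mult[OF that(1)] by (simp add: distrib_left mult.assoc)
  qed
  obtain d where d: "d \<noteq> 0" "d \<in> ideal_inverse I"
    using I unfolding fractional_ideal_def ideal_inverse_def by blast
  obtain y where y: "y \<in> I" "y \<noteq> 0" using I unfolding fractional_ideal_def by blast
  \<comment> \<open>\<open>d\<close> is a denominator of \<open>I\<close>. The nonzero element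
    \<open>c\<close> of \<open>J\<close> will be a common denominator of all powers of
    \<open>x\<close>, since \<open>x ^ k * c = (x ^ k * d) * y\<close>.\<close>
  define c where "c = d * y"
  have c: "c \<in> J" "c \<noteq> 0" using d y by (auto simp: c_def J_def ideal_mult_mem)
  have "1 \<in> J"
  proof (rule ccontr)
    assume "1 \<notin> J"
    then obtain x where x: "\<not> algebraic_int x" "\<And>j. j \<in> J \<Longrightarrow> algebraic_int (x * j)"
      using exists_nonintegral_multiplier[OF Jadd Jmult JO J0] c by (metis singletonD)
    \<comment> \<open>For \<open>y\<close> in \<open>I\<close>, the product \<open>z * y\<close>
      lies in \<open>J\<close>, so \<open>x * (z * y)\<close> is integral.\<close>
    have "x * z \<in> ideal_inverse I" if "z \<in> ideal_inverse I" for z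
      using x(2) ideal_mult_mem[OF that] by (auto simp: ideal_inverse_def J_def mult.assoc)
    hence "x ^ k * d \<in> ideal_inverse I" for k
      by (induction k) (auto simp: d mult.assoc)
    hence xc: "algebraic_int (x ^ k * c)" for k
      using y(1) by (auto simp: ideal_inverse_def c_def mult.assoc)
    obtain m :: nat and c' where m: "m > 0" "algebraic_int c'" "of_nat m = c' * c"
      using exists_integral_cofactor[OF c(2)] by blast
    have "algebraic_int (x ^ k * of_nat m)" for k
      using algebraic_int_times[OF m(2) xc[of k]] by (simp add: m(3) mult_ac)
    then obtain k l where kl: "k < l" "algebraic_int ((x ^ l * of_nat m - x ^ k * of_nat m) / of_nat m)"
      using exists_congruent_pair[OF m(1), of "\<lambda>k. x ^ k * of_nat m"] by blast
    have "algebraic_int (x ^ l - x ^ k)" using kl(2) m(1) by (simp add: diff_divide_distrib)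
    hence "algebraic_int x" using kl(1) by (rule algebraic_int_if_power_diff)
    thus False using x(1) by simp
  qed
  hence "x \<in> J" if "algebraic_int x" for x using Jmult[OF that, of 1] by simp
  thus ?thesis using JO unfolding J_def by blast
qed

text \<open>Any nonzero \<open>y\<close> in \<open>I\<close> is a denominator of the inverse; the
  factor \<open>m\<close> makes it an algebraic integer, as the definition of a fractional ideal
  demands.\<close>

lemma fractional_ideal_inverse:
  assumes I: "fractional_ideal (I :: 'a set)"
  shows "fractional_ideal (ideal_inverse I)"
proof -
  obtain d where d: "d \<noteq> 0" "d \<in> ideal_inverse I"
    using I unfolding fractional_ideal_def ideal_inverse_def by blast
  obtain y where y: "y \<in> I" "y \<noteq> 0" using I unfolding fractional_ideal_def by blast
  obtain m :: nat where m: "m > 0" "algebraic_int (of_nat m * y)"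
    using exists_integral_multiple by blast
  have "algebraic_int (of_nat m * y * x)" if "x \<in> ideal_inverse I" for x
  proof -
    have "algebraic_int (of_nat m * (x * y))"
      by (rule algebraic_int_times) (use that y(1) in \<open>auto simp: ideal_inverse_def\<close>)
    thus ?thesis by (simp add: mult_ac)
  qed
  moreover have "ideal_inverse I \<noteq> {0}" using d by auto
  ultimately show ?thesis
    unfolding fractional_ideal_def using m y(2)
    by (intro conjI ballI allI impI exI[of _ "of_nat m * y"])
      (auto simp: ideal_inverse_def distrib_right mult.assoc
        intro: algebraic_int_plus algebraic_int_times)
qed

lemma ideal_mult_one:
  assumes "fractional_ideal (I :: 'a set)"
  shows "ideal_mult {x. algebraic_int x} I = I"
proof
  show "ideal_mult {x. algebraic_int x} I \<subseteq> I"
    using assms unfolding fractional_ideal_def by (intro ideal_mult_subset) auto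
  show "I \<subseteq> ideal_mult {x. algebraic_int x} I"
    using ideal_mult_mem[of 1 "{x. algebraic_int x}" _ I] by auto
qed

lemma comm_group_ideal_group: "comm_group (ideal_group :: 'a set monoid)"
proof (rule comm_groupI)
  have "{x :: 'a. algebraic_int x} \<noteq> {0}"
    by (metis algebraic_int_1 mem_Collect_eq singletonD zero_neq_one)
  thus "\<one>\<^bsub>ideal_group\<^esub> \<in> carrier (ideal_group :: 'a set monoid)"
    by (auto simp: ideal_group_def fractional_ideal_def intro: algebraic_int_plus algebraic_int_times
        intro!: exI[of _ 1])
  fix I :: "'a set" assume "I \<in> carrier ideal_group"
  hence I: "fractional_ideal I" by (simp add: ideal_group_def)
  show "\<exists>J\<in>carrier ideal_group. J \<otimes>\<^bsub>ideal_group\<^esub> I = \<one>\<^bsub>ideal_group\<^esub>"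
    by (intro bexI[of _ "ideal_inverse I"])
      (simp_all add: ideal_group_def ideal_inverse_mult fractional_ideal_inverse I)
  show "\<one>\<^bsub>ideal_group\<^esub> \<otimes>\<^bsub>ideal_group\<^esub> I = I"
    by (simp add: ideal_group_def ideal_mult_one I)
qed (simp_all add: ideal_group_def fractional_ideal_mult ideal_mult_assoc, rule ideal_mult_commute)

lemma different_in_ideal_group: "(different :: 'a set) \<in> carrier ideal_group"
proof -
  interpret comm_group "ideal_group :: 'a set monoid" by (rule comm_group_ideal_group)
  show ?thesis
    unfolding different_def by (rule inv_closed) (simp add: ideal_group_def fractional_ideal_codifferent)
qed

end

section \<open>Classes modulo squares\<close>

context comm_group
begin

section \<open>The kernel of the map to the quotient modulo squares\<close>

lemma coset_eq_iff:
  assumes P: "subgroup P G" and a: "a \<in> carrier G" and b: "b \<in> carrier G"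
  shows "P #> a = P #> b \<longleftrightarrow> (\<exists>p\<in>P. a = p \<otimes> b)"
proof
  assume "P #> a = P #> b"
  thus "\<exists>p\<in>P. a = p \<otimes> b" using rcos_self[OF a P] by (auto simp: r_coset_def)
next
  assume "\<exists>p\<in>P. a = p \<otimes> b"
  hence "a \<in> P #> b" by (auto simp: r_coset_def)
  thus "P #> a = P #> b" using repr_independence[OF _ b P] by blast
qed

text \<open>The subgroup P G^2, which is the kernel of the map from G to (G/P)/(G/P)^2.\<close>

definition mod_squares :: "'a set \<Rightarrow> 'a set" where
  "mod_squares P = {p \<otimes> (c \<otimes> c) | p c. p \<in> P \<and> c \<in> carrier G}"

lemma subgroup_mod_squares:
  assumes P: "subgroup P G"
  shows "subgroup (mod_squares P) G"
proof (rule subgroupI)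
  have Pc: "p \<in> carrier G" if "p \<in> P" for p using P that by (rule subgroup.mem_carrier)
  show "mod_squares P \<subseteq> carrier G" by (auto simp: mod_squares_def Pc)
  show "mod_squares P \<noteq> {}" using subgroup.one_closed[OF P] by (auto simp: mod_squares_def)
  fix x assume "x \<in> mod_squares P"
  then obtain p c where x: "x = p \<otimes> (c \<otimes> c)" "p \<in> P" "c \<in> carrier G"
    by (auto simp: mod_squares_def)
  have "inv x = inv p \<otimes> (inv c \<otimes> inv c)" using x Pc by (simp add: inv_mult)
  thus "inv x \<in> mod_squares P"
    unfolding mod_squares_def using x subgroup.m_inv_closed[OF P] by blast
  fix y assume "y \<in> mod_squares P"
  then obtain q d where y: "y = q \<otimes> (d \<otimes> d)" "q \<in> P" "d \<in> carrier G"
    by (auto simp: mod_squares_def)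
  have "x \<otimes> y = (p \<otimes> q) \<otimes> ((c \<otimes> d) \<otimes> (c \<otimes> d))" using x y Pc by (simp add: m_ac)
  thus "x \<otimes> y \<in> mod_squares P"
    unfolding mod_squares_def using x y subgroup.m_closed[OF P] by blast
qed

lemma square_in_mod_squares:
  assumes "subgroup P G" "c \<in> carrier G"
  shows "c \<otimes> c \<in> mod_squares P"
proof -
  have "c \<otimes> c = \<one> \<otimes> (c \<otimes> c)" using assms(2) by simp
  thus ?thesis unfolding mod_squares_def using assms subgroup.one_closed by blast
qed

text \<open>Presents the squares of a group as an instance of \<open>mod_squares\<close>; applied to
  the factor group, it shows that its squares form a subgroup.\<close>

lemma mod_squares_triv: "mod_squares {\<one>} = (\<lambda>c. c \<otimes> c) ` carrier G"
  unfolding mod_squares_def by force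

lemma subset_mod_squares:
  assumes "subgroup P G"
  shows "P \<subseteq> mod_squares P"
proof
  fix p assume "p \<in> P"
  moreover from this have "p = p \<otimes> (\<one> \<otimes> \<one>)" using subgroup.mem_carrier[OF assms] by simp
  ultimately show "p \<in> mod_squares P" unfolding mod_squares_def by blast
qed

lemma subgroup_mult_cancel:
  assumes K: "subgroup K G" and "x \<in> carrier G" "k \<in> K"
  shows "x \<otimes> k \<in> K \<longleftrightarrow> x \<in> K"
proof
  assume "x \<otimes> k \<in> K"
  hence "x \<otimes> k \<otimes> inv k \<in> K"
    using subgroup.m_closed[OF K] subgroup.m_inv_closed[OF K] assms(3) by blast
  thus "x \<in> K" using assms subgroup.mem_carrier[OF K] by (simp add: m_assoc)
qed (use assms subgroup.m_closed[OF K] in blast)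

text \<open>Two coset comparisons in a row: modulo the squares of G/P, equality means P a = P (c c
  b) for some c, and modulo P this becomes a = p c c b.\<close>

lemma factor_group_square_class_eq_iff:
  assumes P: "subgroup P G" and a: "a \<in> carrier G" and b: "b \<in> carrier G"
  defines "Sq \<equiv> (\<lambda>c. c \<otimes>\<^bsub>G Mod P\<^esub> c) ` carrier (G Mod P)"
  shows "Sq #>\<^bsub>G Mod P\<^esub> (P #> a) = Sq #>\<^bsub>G Mod P\<^esub> (P #> b) \<longleftrightarrow> a \<otimes> inv b \<in> mod_squares P"
proof -
  interpret N: normal P G using P by (rule subgroup_imp_normal)
  interpret Q: comm_group "G Mod P" using P by (rule abelian_FactGroup)
  have Pc: "p \<in> carrier G" if "p \<in> P" for p using P that by (rule subgroup.mem_carrier)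
  have carr: "carrier (G Mod P) = (\<lambda>c. P #> c) ` carrier G"
    by (auto simp: FactGroup_def RCOSETS_def)
  have Sq: "Sq = Q.mod_squares {\<one>\<^bsub>G Mod P\<^esub>}"
    unfolding Sq_def by (rule Q.mod_squares_triv[symmetric])
  have "subgroup Sq (G Mod P)"
    unfolding Sq by (rule Q.subgroup_mod_squares) (rule Q.triv_subgroup)
  moreover have "P #> a \<in> carrier (G Mod P)" "P #> b \<in> carrier (G Mod P)"
    using a b by (auto simp: carr)
  ultimately have "Sq #>\<^bsub>G Mod P\<^esub> (P #> a) = Sq #>\<^bsub>G Mod P\<^esub> (P #> b) \<longleftrightarrow>
      (\<exists>s\<in>Sq. P #> a = s \<otimes>\<^bsub>G Mod P\<^esub> (P #> b))"
    by (rule Q.coset_eq_iff)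
  also have "\<dots> \<longleftrightarrow> (\<exists>c\<in>carrier G. P #> a = P #> (c \<otimes> c \<otimes> b))"
    unfolding Sq_def carr using b by (simp add: N.rcos_sum)
  also have "\<dots> \<longleftrightarrow> (\<exists>c\<in>carrier G. \<exists>p\<in>P. a = p \<otimes> (c \<otimes> c \<otimes> b))"
    using a b coset_eq_iff[OF P a] by simp
  also have "\<dots> \<longleftrightarrow> (\<exists>c\<in>carrier G. \<exists>p\<in>P. a \<otimes> inv b = p \<otimes> (c \<otimes> c))"
    using a b Pc by (intro bex_cong refl) (simp add: inv_solve_right' m_assoc)
  also have "\<dots> \<longleftrightarrow> a \<otimes> inv b \<in> mod_squares P"
    unfolding mod_squares_def by blast
  finally show ?thesis .
qed

context
  fixes T :: "'a set"
  assumes T: "finite T" "T \<subseteq> carrier G"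
begin

section \<open>Products of powers over a finite set\<close>

lemma finprod_int_pow_closed: "(\<Otimes>v\<in>T. v [^] (e v :: int)) \<in> carrier G"
  using T by (intro finprod_closed) auto

lemma finprod_int_pow_add:
  "(\<Otimes>v\<in>T. v [^] (e v + f v :: int)) = (\<Otimes>v\<in>T. v [^] e v) \<otimes> (\<Otimes>v\<in>T. v [^] f v)"
proof -
  have "(\<Otimes>v\<in>T. v [^] (e v + f v)) = (\<Otimes>v\<in>T. v [^] e v \<otimes> v [^] f v)"
    using T by (intro finprod_cong') (auto simp: int_pow_mult)
  also have "\<dots> = (\<Otimes>v\<in>T. v [^] e v) \<otimes> (\<Otimes>v\<in>T. v [^] f v)"
    using T by (intro finprod_multf) auto
  finally show ?thesis .
qed

lemma finprod_int_pow_neg: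
  "(\<Otimes>v\<in>T. v [^] (- e v :: int)) = inv (\<Otimes>v\<in>T. v [^] e v)"
proof -
  have "(\<Otimes>v\<in>T. v [^] (- e v)) \<otimes> (\<Otimes>v\<in>T. v [^] e v) = (\<Otimes>v\<in>T. v [^] (- e v + e v))"
    by (rule finprod_int_pow_add[symmetric])
  also have "\<dots> = \<one>" by simp
  finally show ?thesis using inv_equality finprod_int_pow_closed by metis
qed

lemma finprod_int_pow_indicator:
  assumes "S \<subseteq> T"
  shows "(\<Otimes>v\<in>T. v [^] (of_bool (v \<in> S) :: int)) = (\<Otimes>v\<in>S. v)"
  using assms T by (intro finprod_mono_neutral_cong_right) auto

lemma finprod_int_pow_fun_upd:
  assumes "u \<in> T"
  shows "(\<Otimes>v\<in>T. v [^] ((e(u := e u + 1)) v :: int)) = u \<otimes> (\<Otimes>v\<in>T. v [^] e v)"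
proof -
  have "(\<Otimes>v\<in>T. v [^] ((e(u := e u + 1)) v)) = (\<Otimes>v\<in>T. v [^] (of_bool (v \<in> {u}) + e v))"
    using T by (intro finprod_cong') (auto simp: add.commute)
  also have "\<dots> = (\<Otimes>v\<in>{u}. v) \<otimes> (\<Otimes>v\<in>T. v [^] e v)"
    using assms by (simp only: finprod_int_pow_add finprod_int_pow_indicator[of "{u}"] insert_subset empty_subsetI simp_thms)
  also have "(\<Otimes>v\<in>{u}. v) = u" using assms T by (subst finprod_insert) auto
  finally show ?thesis .
qed

text \<open>The two products differ by the square of \<open>?h\<close>, the product with halved
  exponents, and squares lie in \<open>K\<close>.\<close>

lemma mult_finprod_int_pow_in_iff:
  assumes K: "subgroup K G" "\<And>c. c \<in> carrier G \<Longrightarrow> c \<otimes> c \<in> K"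
    and x: "x \<in> carrier G"
  shows "x \<otimes> (\<Otimes>v\<in>T. v [^] (e v :: int)) \<in> K \<longleftrightarrow> x \<otimes> (\<Otimes>v\<in>{v \<in> T. odd (e v)}. v) \<in> K"
proof -
  let ?S = "{v \<in> T. odd (e v)}" and ?h = "\<Otimes>v\<in>T. v [^] (e v div 2)"
  have sub: "?S \<subseteq> T" by blast
  have S: "(\<Otimes>v\<in>?S. v) \<in> carrier G" using T by (intro finprod_closed) auto
  have "(\<Otimes>v\<in>T. v [^] e v) = (\<Otimes>v\<in>T. v [^] (of_bool (v \<in> ?S) + (e v div 2 + e v div 2)))"
  proof (intro finprod_cong' refl)
    fix v assume "v \<in> T"
    \<comment> \<open>Integer division rounds down, so the remainder is 0 or 1 for negative
      exponents too.\<close>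
    hence "e v = of_bool (v \<in> ?S) + (e v div 2 + e v div 2)"
      by (cases "even (e v)") (auto elim!: evenE oddE)
    thus "v [^] e v = v [^] (of_bool (v \<in> ?S) + (e v div 2 + e v div 2))" by metis
  qed (use T in auto)
  also have "\<dots> = (\<Otimes>v\<in>?S. v) \<otimes> (?h \<otimes> ?h)"
    by (simp only: finprod_int_pow_add finprod_int_pow_indicator[OF sub])
  finally have "x \<otimes> (\<Otimes>v\<in>T. v [^] e v) = x \<otimes> (\<Otimes>v\<in>?S. v) \<otimes> (?h \<otimes> ?h)"
    using x S finprod_int_pow_closed by (simp add: m_assoc)
  thus ?thesis
    using subgroup_mult_cancel[OF K(1), of "x \<otimes> (\<Otimes>v\<in>?S. v)" "?h \<otimes> ?h"] K(2) x S
      finprod_int_pow_closed by simp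
qed

text \<open>A subset gives its indicator as exponents; exponents give the set where they are odd.
  Both passages keep the parity, and the Boolean \<open>b\<close> covers the even and the odd case
  together.\<close>

lemma exists_subset_iff_exists_exponents:
  assumes K: "subgroup K G" "\<And>c. c \<in> carrier G \<Longrightarrow> c \<otimes> c \<in> K"
    and x: "x \<in> carrier G"
  shows "(\<exists>S\<subseteq>T. (even (card S) \<longleftrightarrow> b) \<and> x \<otimes> (\<Otimes>v\<in>S. v) \<in> K) \<longleftrightarrow>
    (\<exists>e. (even (\<Sum>v\<in>T. e v) \<longleftrightarrow> b) \<and> x \<otimes> (\<Otimes>v\<in>T. v [^] (e v :: int)) \<in> K)"
proof
  assume "\<exists>S\<subseteq>T. (even (card S) \<longleftrightarrow> b) \<and> x \<otimes> (\<Otimes>v\<in>S. v) \<in> K"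
  then obtain S where S: "S \<subseteq> T" "even (card S) \<longleftrightarrow> b" "x \<otimes> (\<Otimes>v\<in>S. v) \<in> K" by blast
  have "{v \<in> T. odd (of_bool (v \<in> S) :: int)} = S" using S(1) by auto
  hence "even (\<Sum>v\<in>T. of_bool (v \<in> S) :: int) \<longleftrightarrow> even (card S)"
    by (simp only: even_sum_iff[OF T(1)])
  hence "(even (\<Sum>v\<in>T. of_bool (v \<in> S) :: int) \<longleftrightarrow> b) \<and>
      x \<otimes> (\<Otimes>v\<in>T. v [^] (of_bool (v \<in> S) :: int)) \<in> K"
    by (simp only: finprod_int_pow_indicator[OF S(1)] S(2,3) simp_thms)
  thus "\<exists>e. (even (\<Sum>v\<in>T. e v) \<longleftrightarrow> b) \<and> x \<otimes> (\<Otimes>v\<in>T. v [^] (e v :: int)) \<in> K"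
    by (rule exI[of _ "\<lambda>v. of_bool (v \<in> S)"])
next
  assume "\<exists>e. (even (\<Sum>v\<in>T. e v) \<longleftrightarrow> b) \<and> x \<otimes> (\<Otimes>v\<in>T. v [^] (e v :: int)) \<in> K"
  then obtain e :: "'a \<Rightarrow> int"
    where "even (\<Sum>v\<in>T. e v) \<longleftrightarrow> b" "x \<otimes> (\<Otimes>v\<in>T. v [^] e v) \<in> K" by blast
  thus "\<exists>S\<subseteq>T. (even (card S) \<longleftrightarrow> b) \<and> x \<otimes> (\<Otimes>v\<in>S. v) \<in> K"
    by (intro exI[of _ "{v \<in> T. odd (e v)}"])
      (simp add: mult_finprod_int_pow_in_iff[OF K x] even_sum_iff[OF T(1)])
qed

end

end

section \<open>Places, principal ideals and the narrow class group\<close>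

lemma finite_place_ideal:
  assumes "v \<in> finite_places"
  shows "0 \<in> v" "v \<noteq> {0}" "\<And>x. x \<in> v \<Longrightarrow> algebraic_int x"
    "\<And>x y. x \<in> v \<Longrightarrow> y \<in> v \<Longrightarrow> x + y \<in> v"
    "\<And>a x. algebraic_int a \<Longrightarrow> x \<in> v \<Longrightarrow> a * x \<in> v"
proof -
  interpret primeideal v integer_ring using assms by (simp add: finite_places_def)
  show "0 \<in> v" using additive_subgroup.zero_closed[OF additive_subgroup_axioms]
    by (simp add: integer_ring_def)
  show "v \<noteq> {0}" using assms by (simp add: finite_places_def)
  show "algebraic_int x" if "x \<in> v" for x using a_subset that by (auto simp: integer_ring_def)
  show "x + y \<in> v" if "x \<in> v" "y \<in> v" for x y
    using additive_subgroup.a_closed[OF additive_subgroup_axioms that]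
    by (simp add: integer_ring_def)
  show "a * x \<in> v" if "algebraic_int a" "x \<in> v" for a x
    using I_l_closed[of x a] that by (simp add: integer_ring_def)
qed

lemma fractional_ideal_finite_place:
  "v \<in> finite_places \<Longrightarrow> fractional_ideal v"
  unfolding fractional_ideal_def using finite_place_ideal[of v]
  by (intro conjI ballI allI impI exI[of _ 1]) auto

text \<open>The additive group of the residue ring has order 3, so three times the class of 1
  vanishes.\<close>

lemma three_in_T3:
  assumes "v \<in> T3"
  shows "(3 :: 'a::field_char_0) \<in> v"
proof -
  let ?R = "integer_ring :: 'a ring"
  interpret primeideal v ?R using assms by (simp add: T3_def finite_places_def)
  interpret Q: ring "?R Quot v" by (rule quotient_is_ring)
  let ?X = "v +>\<^bsub>?R\<^esub> 1"
  have X: "?X \<in> carrier (?R Quot v)"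
    by (auto simp: FactRing_def A_RCOSETS_def' integer_ring_def)
  have "order (add_monoid (?R Quot v)) = 3"
    using assms by (simp add: T3_def residue_order_def order_def)
  hence "add_pow (?R Quot v) (3::nat) ?X = \<zero>\<^bsub>?R Quot v\<^esub>"
    using Q.add.pow_order_eq_1[of ?X] X by simp
  moreover have "add_pow (?R Quot v) (3::nat) ?X = v +>\<^bsub>?R\<^esub> 3"
  proof -
    have *: "(v +>\<^bsub>?R\<^esub> x) \<oplus>\<^bsub>?R Quot v\<^esub> (v +>\<^bsub>?R\<^esub> y) = v +>\<^bsub>?R\<^esub> (x + y)"
      if "algebraic_int x" "algebraic_int y" for x y
      using a_rcos_sum[of x y] that by (simp add: FactRing_def integer_ring_def)
    have "add_pow (?R Quot v) (3::nat) ?X = ?X \<oplus>\<^bsub>?R Quot v\<^esub> ?X \<oplus>\<^bsub>?R Quot v\<^esub> ?X"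
      using X by (simp add: numeral_3_eq_3)
    also have "\<dots> = v +>\<^bsub>?R\<^esub> 3" by (simp add: *)
    finally show ?thesis .
  qed
  ultimately have "v +>\<^bsub>?R\<^esub> 3 = v" by (simp add: FactRing_def)
  moreover have "3 \<in> v +>\<^bsub>?R\<^esub> 3" by (rule a_rcos_self) (simp add: integer_ring_def)
  ultimately show ?thesis by simp
qed

lemma totally_positive_mult:
  "x \<in> totally_positive \<Longrightarrow> y \<in> totally_positive \<Longrightarrow> x * y \<in> totally_positive"
  by (auto simp: totally_positive_def embeddings_def)

lemma totally_positive_inverse:
  assumes "x \<in> totally_positive"
  shows "inverse x \<in> totally_positive"
proof -
  have "\<sigma> (inverse x) > 0" if "\<sigma> \<in> embeddings" for \<sigma> :: "'a \<Rightarrow> real"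
  proof -
    have "\<sigma> x * \<sigma> (inverse x) = \<sigma> (x * inverse x)"
      using that by (simp add: embeddings_def)
    also have "\<dots> = 1" using that assms by (simp add: embeddings_def totally_positive_def)
    finally have "\<sigma> x * \<sigma> (inverse x) > 0" by simp
    moreover have "\<sigma> x > 0" using that assms by (simp add: totally_positive_def)
    ultimately show ?thesis by (simp add: zero_less_mult_iff)
  qed
  thus ?thesis using assms by (simp add: totally_positive_def)
qed

lemma totally_positive_of_nat:
  assumes "n > 0"
  shows "(of_nat n :: 'a::field_char_0) \<in> totally_positive"
proof -
  have "\<sigma> (of_nat n) = real n" if "\<sigma> \<in> embeddings" for \<sigma> :: "'a \<Rightarrow> real"
  proof (induction n)
    case 0
    have "\<sigma> (0 + 0) = \<sigma> 0 + \<sigma> 0" using that unfolding embeddings_def by blast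
    thus ?case by simp
  next
    case (Suc n)
    thus ?case using that by (simp add: embeddings_def)
  qed
  hence "\<sigma> (of_nat n) > 0" if "\<sigma> \<in> embeddings" for \<sigma> :: "'a \<Rightarrow> real" using that assms by (metis of_nat_0_less_iff)
  thus ?thesis using assms by (auto simp: totally_positive_def)
qed

lemma ideal_mult_principal: "ideal_mult (principal x) (principal y) = principal (x * y)"
proof
  show "ideal_mult (principal x) (principal y) \<subseteq> principal (x * y)"
  proof (rule ideal_mult_subset)
    show "0 \<in> principal (x * y)" by (auto simp: principal_def intro!: exI[of _ 0])
    show "a + b \<in> principal (x * y)" if "a \<in> principal (x * y)" "b \<in> principal (x * y)" for a b
      using that by (auto simp: principal_def algebraic_int_plus simp flip: distrib_left)
    show "a * b \<in> principal (x * y)" if ab: "a \<in> principal x" "b \<in> principal y" for a b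
    proof -
      obtain c d where cd: "a = x * c" "algebraic_int c" "b = y * d" "algebraic_int d"
        using ab by (auto simp: principal_def)
      hence "a * b = x * y * (c * d)" by (simp add: mult_ac)
      thus ?thesis using cd algebraic_int_times by (auto simp: principal_def)
    qed
  qed
  show "principal (x * y) \<subseteq> ideal_mult (principal x) (principal y)"
  proof
    fix z assume "z \<in> principal (x * y)"
    then obtain c where c: "z = x * y * c" "algebraic_int c" by (auto simp: principal_def)
    have "x * 1 \<in> principal x" "y * c \<in> principal y" using c(2) by (auto simp: principal_def)
    from ideal_mult_mem[OF this] show "z \<in> ideal_mult (principal x) (principal y)"
      by (simp add: c(1) mult_ac)
  qed
qed

context number_field_type
begin

section \<open>Finiteness of T_3, principal ideals and trivial classes\<close>

text \<open>Each such place contains 3, hence is a union of residue classes modulo 3 and is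
  determined by the representatives it contains.\<close>

lemma finite_T3: "finite (T3 :: 'a set set)"
proof -
  obtain S :: "'a set" where S: "finite S"
    "\<And>x. algebraic_int x \<Longrightarrow> \<exists>s\<in>S. \<exists>y. algebraic_int y \<and> x = s + of_nat 3 * y"
    using finite_residues[of 3] zero_less_numeral by metis
  have "inj_on (\<lambda>v. v \<inter> S) (T3 :: 'a set set)"
  proof (rule inj_onI)
    have le: "v \<subseteq> w" if v: "v \<in> T3" and w: "w \<in> T3" and eq: "v \<inter> S = w \<inter> S" for v w :: "'a set"
    proof
      fix x assume x: "x \<in> v"
      have fv: "v \<in> finite_places" and fw: "w \<in> finite_places" using v w by (auto simp: T3_def)
      obtain s y where sy: "s \<in> S" "algebraic_int y" "x = s + 3 * y"
        using S(2)[OF finite_place_ideal(3)[OF fv x]] by auto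
      have "s = x + (- y) * 3" using sy(3) by simp
      also have "\<dots> \<in> v"
        using x sy(2) three_in_T3[OF v] by (intro finite_place_ideal(4,5)[OF fv]) auto
      finally have "s \<in> w" using sy(1) eq by blast
      hence "s + y * 3 \<in> w"
        using sy(2) three_in_T3[OF w] by (intro finite_place_ideal(4,5)[OF fw]) auto
      thus "x \<in> w" using sy(3) by (simp add: mult.commute)
    qed
    show "v = w" if "v \<in> T3" "w \<in> T3" "v \<inter> S = w \<inter> S" for v w :: "'a set"
      using le[of v w] le[of w v] that by blast
  qed
  moreover have "(\<lambda>v. v \<inter> S) ` T3 \<subseteq> Pow S" by auto
  ultimately show ?thesis using S(1) by (meson finite_Pow_iff inj_on_finite)
qed

lemma fractional_ideal_principal:
  assumes "x \<noteq> (0 :: 'a)"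
  shows "fractional_ideal (principal x)"
proof -
  obtain m :: nat where m: "m > 0" "algebraic_int (of_nat m * x)"
    using exists_integral_multiple by blast
  have "x * 1 \<in> principal x" by (auto simp: principal_def)
  hence "principal x \<noteq> {0}" using assms by auto
  moreover have "0 \<in> principal x" by (auto simp: principal_def intro!: exI[of _ 0])
  moreover have "a * b \<in> principal x" if "algebraic_int a" "b \<in> principal x" for a b
    using that by (auto simp: principal_def mult.left_commute intro!: algebraic_int_times)
  moreover have "a + b \<in> principal x" if "a \<in> principal x" "b \<in> principal x" for a b
    using that by (auto simp: principal_def algebraic_int_plus simp flip: distrib_left)
  moreover have "algebraic_int (of_nat m * z)" if z: "z \<in> principal x" for z
  proof -
    obtain c where c: "z = x * c" "algebraic_int c" using z by (auto simp: principal_def)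
    have "algebraic_int (of_nat m * x * c)" using m(2) c(2) by (rule algebraic_int_times)
    thus ?thesis by (simp add: c(1) mult.assoc)
  qed
  ultimately show ?thesis
    unfolding fractional_ideal_def using m(1)
    by (intro conjI ballI allI impI exI[of _ "of_nat m"]) auto
qed

sublocale ideals: comm_group "ideal_group :: 'a set monoid"
  by (rule comm_group_ideal_group)

lemma inv_principal:
  assumes "x \<noteq> (0 :: 'a)"
  shows "inv\<^bsub>ideal_group\<^esub> (principal x) = principal (inverse x)"
proof (rule ideals.inv_equality)
  have "principal (inverse x) \<otimes>\<^bsub>ideal_group\<^esub> principal x = principal 1"
    using assms by (simp add: ideal_group_def ideal_mult_principal)
  also have "\<dots> = \<one>\<^bsub>ideal_group\<^esub>" by (simp add: ideal_group_def principal_def)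
  finally show "principal (inverse x) \<otimes>\<^bsub>ideal_group\<^esub> principal x = \<one>\<^bsub>ideal_group\<^esub>" .
qed (use assms in \<open>simp_all add: ideal_group_def fractional_ideal_principal\<close>)

lemma subgroup_narrow_principal: "subgroup narrow_principal (ideal_group :: 'a set monoid)"
proof (rule ideals.subgroupI)
  have nz: "x \<noteq> 0" if "x \<in> totally_positive" for x :: 'a using that by (simp add: totally_positive_def)
  show "narrow_principal \<subseteq> carrier (ideal_group :: 'a set monoid)"
    using fractional_ideal_principal nz by (auto simp: narrow_principal_def ideal_group_def)
  show "narrow_principal \<noteq> ({} :: 'a set set)"
    using totally_positive_of_nat[of 1] by (auto simp: narrow_principal_def)
  fix I :: "'a set" assume "I \<in> narrow_principal"
  then obtain x where x: "I = principal x" "x \<in> totally_positive" by (auto simp: narrow_principal_def)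
  show "inv\<^bsub>ideal_group\<^esub> I \<in> narrow_principal"
    using x nz by (simp add: inv_principal narrow_principal_def totally_positive_inverse)
  fix J :: "'a set" assume "J \<in> narrow_principal"
  then obtain y where y: "J = principal y" "y \<in> totally_positive" by (auto simp: narrow_principal_def)
  show "I \<otimes>\<^bsub>ideal_group\<^esub> J \<in> narrow_principal"
    using x y by (simp add: ideal_group_def ideal_mult_principal narrow_principal_def totally_positive_mult)
qed

text \<open>The fractional ideals that become trivial in the narrow class group modulo squares: the
  subgroup K of the overview.\<close>

abbreviation trivial_classes :: "'a set set" where
  "trivial_classes \<equiv> ideals.mod_squares narrow_principal"

lemma class_mod_squares_eq_iff:
  assumes "I \<in> carrier ideal_group" "J \<in> carrier ideal_group"
  shows "class_mod_squares (I :: 'a set) = class_mod_squares J \<longleftrightarrow>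
    I \<otimes>\<^bsub>ideal_group\<^esub> inv\<^bsub>ideal_group\<^esub> J \<in> trivial_classes"
  using ideals.factor_group_square_class_eq_iff[OF subgroup_narrow_principal assms]
  unfolding class_mod_squares_def narrow_class_squares_def narrow_class_group_def .

lemma T3_subset: "T3 \<subseteq> carrier (ideal_group :: 'a set monoid)"
  by (auto simp: T3_def ideal_group_def fractional_ideal_finite_place)

lemmas subgroup_trivial_classes = ideals.subgroup_mod_squares[OF subgroup_narrow_principal]
lemmas square_in_trivial_classes = ideals.square_in_mod_squares[OF subgroup_narrow_principal]

section \<open>Triples, exponents and parity\<close>

text \<open>Equality of the class of \<open>I\<close> with that of a product says that
  \<open>I\<close> times the inverse product is a trivial class. Negating all exponents preserves an
  even sum, so the inverse disappears.\<close>

lemma class_in_H_bar_iff: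
  assumes I: "I \<in> carrier (ideal_group :: 'a set monoid)"
  shows "class_mod_squares I \<in> H_bar \<longleftrightarrow> (\<exists>e. even (\<Sum>v\<in>T3. e v) \<and>
    I \<otimes>\<^bsub>ideal_group\<^esub> (\<Otimes>\<^bsub>ideal_group\<^esub>v\<in>T3. v [^]\<^bsub>ideal_group\<^esub> (e v :: int)) \<in> trivial_classes)"
    (is "_ \<longleftrightarrow> (\<exists>e. even (?s e) \<and> I \<otimes>\<^bsub>ideal_group\<^esub> ?h e \<in> _)")
proof -
  note closed = ideals.finprod_int_pow_closed[OF finite_T3 T3_subset]
  have "class_mod_squares I \<in> H_bar \<longleftrightarrow> (\<exists>e. even (?s e) \<and> class_mod_squares I = class_mod_squares (?h e))"
    unfolding H_bar_def H_group_def by blast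
  also have "\<dots> \<longleftrightarrow> (\<exists>e. even (?s e) \<and> I \<otimes>\<^bsub>ideal_group\<^esub> inv\<^bsub>ideal_group\<^esub> (?h e) \<in> trivial_classes)"
    using class_mod_squares_eq_iff[OF I closed] by simp
  also have "\<dots> \<longleftrightarrow> (\<exists>e. even (?s e) \<and> I \<otimes>\<^bsub>ideal_group\<^esub> ?h (\<lambda>v. - e v) \<in> trivial_classes)"
    by (simp only: ideals.finprod_int_pow_neg[OF finite_T3 T3_subset])
  also have "\<dots> \<longleftrightarrow> (\<exists>e. even (?s e) \<and> I \<otimes>\<^bsub>ideal_group\<^esub> ?h e \<in> trivial_classes)"
  proof safe
    fix e assume "even (?s e)" "I \<otimes>\<^bsub>ideal_group\<^esub> ?h (\<lambda>v. - e v) \<in> trivial_classes"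
    thus "\<exists>e. even (?s e) \<and> I \<otimes>\<^bsub>ideal_group\<^esub> ?h e \<in> trivial_classes"
      by (intro exI[of _ "\<lambda>v. - e v"]) (simp add: sum_negf)
  next
    fix e assume "even (?s e)" "I \<otimes>\<^bsub>ideal_group\<^esub> ?h e \<in> trivial_classes"
    thus "\<exists>e. even (?s e) \<and> I \<otimes>\<^bsub>ideal_group\<^esub> ?h (\<lambda>v. - e v) \<in> trivial_classes"
      by (intro exI[of _ "\<lambda>v. - e v"]) (simp add: sum_negf)
  qed
  finally show ?thesis .
qed

text \<open>Eliminates the element and the square root ideal from the triple: the ideal of 8 times a
  totally positive element is a trivial class and cancels.\<close>

lemma exists_triple_iff:
  "(\<exists>\<beta> S3 I. (\<beta>, S3, I) \<in> G_triples (Sinf :: ('a \<Rightarrow> real) set)) \<longleftrightarrow>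
    (\<exists>S3\<subseteq>T3. (even (card S3) \<longleftrightarrow> even (card (S2 :: 'a set set) + card Sinf)) \<and>
      different \<otimes>\<^bsub>ideal_group\<^esub> (\<Otimes>\<^bsub>ideal_group\<^esub>v\<in>S3. v) \<in> trivial_classes)"
proof -
  note d = different_in_ideal_group
  have closed: "(\<Otimes>\<^bsub>ideal_group\<^esub>v\<in>S3. v) \<in> carrier (ideal_group :: 'a set monoid)" if "S3 \<subseteq> T3" for S3
    using that T3_subset by (intro ideals.finprod_closed) auto
  show ?thesis
  proof
    assume "\<exists>\<beta> S3 I. (\<beta>, S3, I) \<in> G_triples Sinf"
    then obtain \<beta> :: 'a and S3 I where G: "(\<beta>, S3, I) \<in> G_triples Sinf" by blast
    let ?p = "principal (8 * \<beta>)" and ?x = "different \<otimes>\<^bsub>ideal_group\<^esub> (\<Otimes>\<^bsub>ideal_group\<^esub>v\<in>S3. v)"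
    have S3: "S3 \<subseteq> T3" and I: "I \<in> carrier ideal_group"
      and eq: "?p \<otimes>\<^bsub>ideal_group\<^esub> different \<otimes>\<^bsub>ideal_group\<^esub> (\<Otimes>\<^bsub>ideal_group\<^esub>v\<in>S3. v) = I \<otimes>\<^bsub>ideal_group\<^esub> I"
      and \<beta>: "\<beta> \<in> totally_positive"
      using G by (auto simp: G_triples_def ideal_group_def)
    have p: "?p \<in> narrow_principal"
      using totally_positive_mult[OF totally_positive_of_nat[of 8] \<beta>] by (auto simp: narrow_principal_def)
    hence pc: "?p \<in> carrier ideal_group"
      using subgroup.mem_carrier[OF subgroup_narrow_principal] by blast
    have "?x \<otimes>\<^bsub>ideal_group\<^esub> ?p = I \<otimes>\<^bsub>ideal_group\<^esub> I"
      using eq pc d closed[OF S3] by (simp add: ideals.m_ac)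
    hence "?x \<otimes>\<^bsub>ideal_group\<^esub> ?p \<in> trivial_classes" using square_in_trivial_classes[OF I] by simp
    hence "?x \<in> trivial_classes"
      using ideals.subgroup_mult_cancel[OF subgroup_trivial_classes, of ?x ?p] d closed[OF S3] p
        ideals.subset_mod_squares[OF subgroup_narrow_principal] by auto
    moreover have "even (card S3) \<longleftrightarrow> even (card (S2 :: 'a set set) + card Sinf)"
      using G by (auto simp: G_triples_def)
    ultimately show "\<exists>S3\<subseteq>T3. (even (card S3) \<longleftrightarrow> even (card (S2 :: 'a set set) + card Sinf)) \<and>
        different \<otimes>\<^bsub>ideal_group\<^esub> (\<Otimes>\<^bsub>ideal_group\<^esub>v\<in>S3. v) \<in> trivial_classes"
      using S3 by blast
  next
    assume "\<exists>S3\<subseteq>T3. (even (card S3) \<longleftrightarrow> even (card (S2 :: 'a set set) + card Sinf)) \<and>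
        different \<otimes>\<^bsub>ideal_group\<^esub> (\<Otimes>\<^bsub>ideal_group\<^esub>v\<in>S3. v) \<in> trivial_classes"
    then obtain S3 :: "'a set set" where S3: "S3 \<subseteq> T3"
      and par: "even (card S3) \<longleftrightarrow> even (card (S2 :: 'a set set) + card Sinf)"
      and x: "different \<otimes>\<^bsub>ideal_group\<^esub> (\<Otimes>\<^bsub>ideal_group\<^esub>v\<in>S3. v) \<in> trivial_classes"
      by blast
    let ?x = "different \<otimes>\<^bsub>ideal_group\<^esub> (\<Otimes>\<^bsub>ideal_group\<^esub>v\<in>S3. v)"
    from x obtain p c where pc: "?x = p \<otimes>\<^bsub>ideal_group\<^esub> (c \<otimes>\<^bsub>ideal_group\<^esub> c)"
        "p \<in> narrow_principal" "c \<in> carrier ideal_group"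
      unfolding ideals.mod_squares_def by blast
    obtain \<gamma> where \<gamma>: "p = principal \<gamma>" "\<gamma> \<in> totally_positive"
      using pc(2) by (auto simp: narrow_principal_def)
    have \<gamma>0: "\<gamma> \<noteq> 0" using \<gamma>(2) by (simp add: totally_positive_def)
    have p: "p \<in> carrier ideal_group"
      using subgroup.mem_carrier[OF subgroup_narrow_principal pc(2)] .
    \<comment> \<open>Solves 8 \<beta> = \<gamma>^(-1), so that the principal ideal of 8 \<beta>
      cancels \<open>p\<close> and leaves the square of \<open>c\<close>.\<close>
    define \<beta> where "\<beta> = inverse (of_nat 8) * inverse \<gamma>"
    have \<beta>: "\<beta> \<in> totally_positive"
      unfolding \<beta>_def using \<gamma>(2)
      by (intro totally_positive_mult totally_positive_inverse totally_positive_of_nat) auto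
    have "principal (8 * \<beta>) = inv\<^bsub>ideal_group\<^esub> p"
      unfolding \<gamma>(1) inv_principal[OF \<gamma>0] by (simp add: \<beta>_def)
    hence "principal (8 * \<beta>) \<otimes>\<^bsub>ideal_group\<^esub> different \<otimes>\<^bsub>ideal_group\<^esub> (\<Otimes>\<^bsub>ideal_group\<^esub>v\<in>S3. v)
        = inv\<^bsub>ideal_group\<^esub> p \<otimes>\<^bsub>ideal_group\<^esub> ?x"
      using p d closed[OF S3] by (simp add: ideals.m_assoc)
    also have "\<dots> = c \<otimes>\<^bsub>ideal_group\<^esub> c"
      unfolding pc(1) using p pc(3) by (simp flip: ideals.m_assoc)
    finally have "(\<beta>, S3, c) \<in> G_triples Sinf"
      using \<beta> S3 par pc(3) by (auto simp: G_triples_def ideal_group_def)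
    thus "\<exists>\<beta> S3 I. (\<beta>, S3, I) \<in> G_triples Sinf" by blast
  qed
qed

lemma exists_triple_iff_exponents:
  "(\<exists>\<beta> S3 I. (\<beta>, S3, I) \<in> G_triples (Sinf :: ('a \<Rightarrow> real) set)) \<longleftrightarrow>
    (\<exists>e. (even (\<Sum>v\<in>T3. e v) \<longleftrightarrow> even (card (S2 :: 'a set set) + card Sinf)) \<and>
      different \<otimes>\<^bsub>ideal_group\<^esub> (\<Otimes>\<^bsub>ideal_group\<^esub>v\<in>T3. v [^]\<^bsub>ideal_group\<^esub> (e v :: int)) \<in> trivial_classes)"
  unfolding exists_triple_iff
  by (rule ideals.exists_subset_iff_exists_exponents[OF finite_T3 T3_subset
        subgroup_trivial_classes square_in_trivial_classes different_in_ideal_group])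

text \<open>Raising the exponent at \<open>v0\<close> by one is a bijection from even to odd
  exponent sums and multiplies the product by \<open>v0\<close>.\<close>

lemma exists_odd_exponents_iff:
  assumes v0: "v0 \<in> (T3 :: 'a set set)" and I: "I \<in> carrier (ideal_group :: 'a set monoid)"
  shows "(\<exists>e. odd (\<Sum>v\<in>T3. e v) \<and>
      I \<otimes>\<^bsub>ideal_group\<^esub> (\<Otimes>\<^bsub>ideal_group\<^esub>v\<in>T3. v [^]\<^bsub>ideal_group\<^esub> (e v :: int)) \<in> trivial_classes) \<longleftrightarrow>
    class_mod_squares (I \<otimes>\<^bsub>ideal_group\<^esub> v0) \<in> H_bar"
    (is "(\<exists>e. odd (?s e) \<and> I \<otimes>\<^bsub>ideal_group\<^esub> ?h e \<in> _) \<longleftrightarrow> _")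
proof -
  note closed = ideals.finprod_int_pow_closed[OF finite_T3 T3_subset]
  let ?up = "\<lambda>e. e(v0 := e v0 + 1 :: int)"
  have v0c: "v0 \<in> carrier ideal_group" using v0 T3_subset by blast
  have sum: "?s (?up e) = ?s e + 1" for e
    using v0 finite_T3 by (simp add: sum.remove[of T3 v0])
  have "I \<otimes>\<^bsub>ideal_group\<^esub> ?h (?up e) = I \<otimes>\<^bsub>ideal_group\<^esub> (v0 \<otimes>\<^bsub>ideal_group\<^esub> ?h e)" for e
    by (simp only: ideals.finprod_int_pow_fun_upd[OF finite_T3 T3_subset v0])
  hence h: "I \<otimes>\<^bsub>ideal_group\<^esub> ?h (?up e) = I \<otimes>\<^bsub>ideal_group\<^esub> v0 \<otimes>\<^bsub>ideal_group\<^esub> ?h e" for e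
    using ideals.m_assoc[OF I v0c closed] by simp
  have up: "\<exists>e'. e = ?up e'" for e
    by (intro exI[of _ "e(v0 := e v0 - 1)"]) simp
  have "class_mod_squares (I \<otimes>\<^bsub>ideal_group\<^esub> v0) \<in> H_bar \<longleftrightarrow>
      (\<exists>e. even (?s e) \<and> I \<otimes>\<^bsub>ideal_group\<^esub> v0 \<otimes>\<^bsub>ideal_group\<^esub> ?h e \<in> trivial_classes)"
    using I v0c by (intro class_in_H_bar_iff) simp
  also have "\<dots> \<longleftrightarrow> (\<exists>e. odd (?s (?up e)) \<and> I \<otimes>\<^bsub>ideal_group\<^esub> ?h (?up e) \<in> trivial_classes)"
    unfolding h sum by simp
  also have "\<dots> \<longleftrightarrow> (\<exists>e. odd (?s e) \<and> I \<otimes>\<^bsub>ideal_group\<^esub> ?h e \<in> trivial_classes)"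
    using up by metis
  finally show ?thesis ..
qed

end

theorem theorem2:
  fixes n :: nat
    and infty :: "nat \<Rightarrow> 'a::field_char_0 \<Rightarrow> real"
    and w :: "nat \<Rightarrow> real"
  assumes number_field: "number_field TYPE('a)"
    and totally_real: "totally_real TYPE('a)"
    and degree: "field_degree TYPE('a) = n"
    and split_2: "splits_completely 2 TYPE('a)"
    and infty: "bij_betw infty {1..n} embeddings"
    and w: "\<forall>i\<in>{1..n}. w i \<in> {1/2, 3/2}"
  shows
    "(even (card (S2 :: 'a set set) + card (S_infty n infty w)) \<longrightarrow>
       ((\<exists>\<beta> S3 I. (\<beta>, S3, I) \<in> G_triples (S_infty n infty w)) \<longleftrightarrow>
          class_mod_squares (different :: 'a set) \<in> H_bar)) \<and>
     (odd (card (S2 :: 'a set set) + card (S_infty n infty w)) \<longrightarrow>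
       (\<forall>v0 :: 'a set. ((T3 :: 'a set set) \<noteq> {} \<longrightarrow> v0 \<in> T3) \<longrightarrow>
         ((\<exists>\<beta> S3 I. (\<beta>, S3, I) \<in> G_triples (S_infty n infty w)) \<longleftrightarrow>
            (T3 :: 'a set set) \<noteq> {} \<and>
            class_mod_squares (different \<otimes>\<^bsub>ideal_group\<^esub> v0) \<in> H_bar)))"
proof -
  interpret number_field_type "TYPE('a)" by unfold_locales (rule number_field)
  show ?thesis
  proof (intro conjI impI allI)
    assume "even (card (S2 :: 'a set set) + card (S_infty n infty w))"
    thus "(\<exists>\<beta> S3 I. (\<beta>, S3, I) \<in> G_triples (S_infty n infty w)) \<longleftrightarrow>
        class_mod_squares (different :: 'a set) \<in> H_bar"
      unfolding exists_triple_iff_exponents class_in_H_bar_iff[OF different_in_ideal_group] by simp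
  next
    fix v0 :: "'a set"
    assume odd: "odd (card (S2 :: 'a set set) + card (S_infty n infty w))"
      and v0: "(T3 :: 'a set set) \<noteq> {} \<longrightarrow> v0 \<in> T3"
    show "(\<exists>\<beta> S3 I. (\<beta>, S3, I) \<in> G_triples (S_infty n infty w)) \<longleftrightarrow>
        (T3 :: 'a set set) \<noteq> {} \<and>
        class_mod_squares (different \<otimes>\<^bsub>ideal_group\<^esub> v0) \<in> H_bar"
    proof (cases "(T3 :: 'a set set) = {}")
      \<comment> \<open>The only exponent sum is the empty one, which is 0 and even; so both sides
        are false.\<close>
      case True
      thus ?thesis unfolding exists_triple_iff_exponents using odd by simp
    next
      case False
      with v0 have "v0 \<in> T3" by simp
      from exists_odd_exponents_iff[OF this different_in_ideal_group] show ?thesis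
        unfolding exists_triple_iff_exponents using odd False by simp
    qed
  qed
qed

end
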